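(* For each $\mathfrak{m}\in\mathcal{P}_2(2k)$ one has the formal expansion in powers of $d^{-1}$ $$(2d)^{|\mathfrak{m}|+k}\,|\mathrm{Wg}^{\mathrm{Sp}}(\mathfrak{m},d)|=\sum_{g\ge0}\#P(\mathfrak{m},|\mathfrak{m}|+g)\,(2d)^{-g}.$$
   Context: $\mathcal{P}_2(2k)$ is the set of pair partitions of $\{1,\dots,2k\}$; $\mathcal{P}_2(0)=\{\emptyset\}$; $S_{2k}$ acts on it by applying the permutation to every element of every block. The coset-type of $\mathfrak{m}$ is the partition $\mu$ of $k$ such that the connected components of the graph on $\{1,\dots,2k\}$ whose edges are the blocks of $\mathfrak{e}_k=\{1,2\}\cdots\{2k-1,2k\}$ and of $\mathfrak{m}$ have sizes $2\mu_1,2\mu_2,\dots$; $|\mathfrak{m}|=k-\ell(\mu)$. The orthogonal Weingarten function $\mathrm{Wg}^{\mathrm{O}}(\mathfrak{m},d)=\int_{\mathrm{O}(d)}u_{i_1j_1}\cdots u_{i_{2k}j_{2k}}\,d\mu(U)$ (for integers $d\ge2k$, $\mu$ Haar probability on $\mathrm{O}(d)$, $\mathbf{i}$ with $i_r=i_s\iff\{r,s\}\in\mathfrak{e}_k$, $\mathbf{j}$ with $j_r=j_s\iff\{r,s\}\in\mathfrak{m}$, for $r\neq s$) is a rational function of $d$. The symplectic Weingarten function $\mathrm{Wg}^{\mathrm{Sp}}(\mathfrak{m},d)$ (the Weingarten function of the compact symplectic group $\mathrm{Sp}(d)=\{g\in\mathrm{U}(2d):gJ=Jg\}$, $J=\begin{pmatrix}0&I_d\\-I_d&0\end{pmatrix}$)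 satisfies $\pm\mathrm{Wg}^{\mathrm{Sp}}(\mathfrak{m},d)=\mathrm{Wg}^{\mathrm{O}}(\mathfrak{m},-2d)$ up to sign, where the right side is the rational function $\mathrm{Wg}^{\mathrm{O}}(\mathfrak{m},\cdot)$ evaluated at $-2d$. The orthogonal Weingarten graph has vertex set $\bigsqcup_{k\ge0}\mathcal{P}_2(2k)$, a solid arrow $\mathfrak{m}\to(i,2k-1).\mathfrak{m}$ for every $\mathfrak{m}\in\mathcal{P}_2(2k)$ and $1\le i<2k-1$, and a dashed arrow $\mathfrak{m}\dashrightarrow\mathfrak{m}^{\downarrow}$ whenever $\{2k-1,2k\}\in\mathfrak{m}$, with $\mathfrak{m}^{\downarrow}$ being $\mathfrak{m}$ with that block removed. $P(\mathfrak{m},l)$ is the set of paths $(\mathfrak{m}_0=\mathfrak{m},\dots,\mathfrak{m}_{l+k}=\emptyset)$ following arrows at each step, using $l$ solid and $k$ dashed arrows.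
   Formalization: The compact symplectic group is taken as the unitary g with gJ = J·conj(g) (equivalently gᵀJg = J); the printed condition gJ = Jg lacks the conjugate and describes a copy of U(d)×U(d), for which the integrals vanish. *)

theory Defs
  imports
    "HOL-Probability.Probability"
    "HOL-Combinatorics.Transposition"
    "HOL-Computational_Algebra.Formal_Laurent_Series"
    "Jordan_Normal_Form.Schur_Decomposition"
begin

text \<open>A pair partition is the set of its blocks.  Its half-size \<open>k\<close> is the number of blocks, so
  the sets \<open>pair_partitions k\<close> are pairwise disjoint and their plain union is a disjoint union.\<close>

type_synonym pairing = "nat set set"

definition pair_partitions :: "nat \<Rightarrow> pairing set" where
  "pair_partitions k = {m. partition_on {1..2 * k} m \<and> (\<forall>b\<in>m. card b = 2)}"

definition perm_act :: "(nat \<Rightarrow> nat) \<Rightarrow> pairing \<Rightarrow> pairing" where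
  "perm_act \<sigma> m = (\<lambda>b. \<sigma> ` b) ` m"

definition base_pairing :: "nat \<Rightarrow> pairing" where
  "base_pairing k = {{2 * r - 1, 2 * r} | r. r \<in> {1..k}}"

definition pairing_components :: "nat \<Rightarrow> pairing \<Rightarrow> nat set set" where
  "pairing_components k m =
     {1..2 * k} // {(x, y). x \<in> {1..2 * k} \<and> y \<in> {1..2 * k} \<and>
                            (x, y) \<in> {(u, v). {u, v} \<in> base_pairing k \<union> m}\<^sup>*}"

definition coset_type :: "nat \<Rightarrow> pairing \<Rightarrow> nat multiset" where
  "coset_type k m = image_mset (\<lambda>C. card C div 2) (mset_set (pairing_components k m))"

definition pairing_length :: "nat \<Rightarrow> pairing \<Rightarrow> nat" where
  "pairing_length k m = k - size (coset_type k m)"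

definition solid_arrow :: "pairing \<Rightarrow> pairing \<Rightarrow> bool" where
  "solid_arrow m n \<longleftrightarrow>
     (\<exists>k i. m \<in> pair_partitions k \<and> 1 \<le> i \<and> i < 2 * k - 1 \<and>
            n = perm_act (Transposition.transpose i (2 * k - 1)) m)"

definition dashed_arrow :: "pairing \<Rightarrow> pairing \<Rightarrow> bool" where
  "dashed_arrow m n \<longleftrightarrow>
     (\<exists>k. m \<in> pair_partitions k \<and> {2 * k - 1, 2 * k} \<in> m \<and> n = m - {{2 * k - 1, 2 * k}})"

text \<open>Paths are recorded by their vertices.  This loses nothing: a solid arrow preserves the number
  of blocks and a dashed one lowers it, so the kind of each step is determined, and distinct \<open>i\<close>
  give distinct targets, so the graph has no multiple arrows.  It does have loops
  (\<open>{i, 2k - 1} \<in> m\<close>), and these count as solid steps.\<close>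

definition weingarten_paths :: "nat \<Rightarrow> pairing \<Rightarrow> nat \<Rightarrow> pairing list set" where
  "weingarten_paths k m l =
     {p. length p = l + k + 1 \<and> p ! 0 = m \<and> p ! (l + k) = {} \<and>
         (\<forall>t<l + k. solid_arrow (p ! t) (p ! Suc t) \<or> dashed_arrow (p ! t) (p ! Suc t)) \<and>
         card {t. t < l + k \<and> solid_arrow (p ! t) (p ! Suc t)} = l \<and>
         card {t. t < l + k \<and> dashed_arrow (p ! t) (p ! Suc t)} = k}"

definition symplectic_J :: "nat \<Rightarrow> complex mat" where
  "symplectic_J d = four_block_mat (0\<^sub>m d d) (1\<^sub>m d) (- 1\<^sub>m d) (0\<^sub>m d d)"

text \<open>For a unitary \<open>g\<close> the condition \<open>g J = J (cnj g)\<close> is the same as \<open>g\<^sup>T J g = J\<close>.  The complex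
  conjugate is essential: the unitary matrices commuting with \<open>J\<close> form a copy of
  \<open>U(d) \<times> U(d)\<close>.\<close>

definition Sp :: "nat \<Rightarrow> complex mat set" where
  "Sp d = {g \<in> carrier_mat (2 * d) (2 * d).
             g * mat_adjoint g = 1\<^sub>m (2 * d) \<and>
             g * symplectic_J d = symplectic_J d * map_mat cnj g}"

text \<open>The Borel \<open>\<sigma>\<close>-algebra of a set of \<open>n \<times> n\<close> matrices, as a subspace of \<open>\<complex>\<close> to the power
  \<open>n\<^sup>2\<close>: it is generated by the matrix entries.\<close>

definition borel_matrices :: "nat \<Rightarrow> complex mat set \<Rightarrow> complex mat measure" where
  "borel_matrices n G =
     vimage_algebra G (\<lambda>g. \<lambda>(i, j)\<in>{..<n} \<times> {..<n}. g $$ (i, j))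
       (PiM ({..<n} \<times> {..<n}) (\<lambda>_. borel))"

text \<open>The Haar probability measure of a compact group \<open>G\<close> of \<open>n \<times> n\<close> matrices: the bi-invariant
  Borel probability measure on \<open>G\<close>.\<close>

definition haar_probability :: "nat \<Rightarrow> complex mat set \<Rightarrow> complex mat measure \<Rightarrow> bool" where
  "haar_probability n G \<mu> \<longleftrightarrow>
     prob_space \<mu> \<and> space \<mu> = G \<and> sets \<mu> = sets (borel_matrices n G) \<and>
     (\<forall>h\<in>G. distr \<mu> \<mu> (\<lambda>g. h * g) = \<mu> \<and> distr \<mu> \<mu> (\<lambda>g. g * h) = \<mu>)"

text \<open>The symplectic Weingarten function is the system of coefficients in
  \[ \int_{\mathrm{Sp}(d)} g_{i_1 j_1} \cdots g_{i_{2k} j_{2k}}\,dg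
     = \sum_{m, n} \Delta_m(i)\, \Delta_n(j)\, \mathrm{Wg}(m, n), \qquad
     \Delta_m(i) = \prod_{\{a < b\} \in m} J_{i_a i_b}, \]
  and its value at the single pair partition \<open>n\<close> is the coefficient of the pair formed by the base
  pairing and \<open>n\<close>.  To isolate it, each block \<open>{a < b}\<close> is given indices with
  \<open>J\<close>-entry \<open>1\<close>, different blocks using different basis pairs: \<open>a\<close> gets the index of
  the basis vector number \<open>a\<close> and \<open>b\<close> that of its \<open>J\<close>-partner, number \<open>a + d\<close>
  (matrix indices start at \<open>0\<close>, hence the shift by one).  Then \<open>\<Delta>\<close> is \<open>1\<close> at the given pairing
  and \<open>0\<close> at all others.  This needs \<open>d \<ge> 2k\<close>, and for smaller \<open>d\<close> the function below is
  meaningless; the rational function of \<open>d\<close> that it represents is determined by the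
  large \<open>d\<close>.\<close>

definition symplectic_index :: "nat \<Rightarrow> pairing \<Rightarrow> nat \<Rightarrow> nat" where
  "symplectic_index d m r =
     (let b = (THE b. b \<in> m \<and> r \<in> b) in if r = Min b then r - 1 else Min b - 1 + d)"

definition Wg_Sp :: "complex mat measure \<Rightarrow> nat \<Rightarrow> pairing \<Rightarrow> nat \<Rightarrow> complex" where
  "Wg_Sp \<mu> k m d =
     (\<integral>g. (\<Prod>r\<in>{1..2 * k}.
            g $$ (symplectic_index d (base_pairing k) r, symplectic_index d m r)) \<partial>\<mu>)"

text \<open>The image of a polynomial in \<open>d\<close> under the substitution of \<open>X\<^sup>-\<^sup>1\<close> for \<open>d\<close>.  It extends
  to an embedding of the rational functions of \<open>d\<close> into the field of formal Laurent series
  in \<open>X\<close>, which is the expansion at \<open>d = \<infinity>\<close>.\<close>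

definition poly_at_infinity :: "real poly \<Rightarrow> real fls" where
  "poly_at_infinity p = poly (map_poly fls_const p) fls_X_inv"

text \<open>\<open>f\<close> is (for large \<open>d\<close>) a rational function of \<open>d\<close>, whose formal expansion is
  \<open>\<Sum>g. a g * d\<^sup>-\<^sup>g\<close>.  The rational function is unique, as it is known at infinitely many points.\<close>

definition has_formal_expansion :: "(nat \<Rightarrow> real) \<Rightarrow> (nat \<Rightarrow> real) \<Rightarrow> bool" where
  "has_formal_expansion f a \<longleftrightarrow>
     (\<exists>p q :: real poly. q \<noteq> 0 \<and>
        (\<forall>\<^sub>F d in sequentially. f d = poly p (real d) / poly q (real d)) \<and>
        poly_at_infinity p / poly_at_infinity q = fps_to_fls (Abs_fps a))"

end

theory Submission
  imports Defs
begin

text \<open>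
  Differentiating the invariance of the Haar measure under the one-parameter subgroups of
  \<open>Sp(d)\<close> at the identity and contracting with \<open>g\<^sup>T J g = J\<close> gives, for the moments with the row
  indices of the base pairing and arbitrary column indices \<open>j\<close>,
  \[ 2d\, I_k(j) + \sum_{r < 2k - 1} I_k(j \circ (r, 2k - 1)) = J_{j_{2k-1}, j_{2k}}\, I_{k-1}(j). \]
  After multiplication by the Pfaffian sign of \<open>j\<close>, which every transposition reverses, all signs
  become positive, and the relation is the recursion along the first arrow of a path satisfied by
  \<open>\<Sum>l. #P(m, l) (2 d) ^ (- l - k)\<close>.  For large \<open>d\<close> the linear system has only one solution.  The
  generating functions of the path numbers solve a linear system over the rational functions,
  hence are rational, and no path has fewer than \<open>|m|\<close> solid steps because a solid step changes
  the number of components by at most one.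
\<close>

text \<open>A solid arrow changes the column indices together with the pairing and leads away from
  the normalised indices \<open>symplectic_index d m\<close>. So moments and path counts are
  compared for all pairs of a pairing and column indices compatible with it, a class that both kinds
  of arrow preserve. That the signed moment depends on the pairing alone is then a consequence of
  uniqueness and not a preliminary step.

  Uniqueness is proved for each fixed \<open>d\<close> as a contraction, which needs bounded
  unknowns (matrix entries in \<open>Sp d\<close> have modulus at most 1) and path series that
  converge at the point \<open>1 / d\<close>. Rationality therefore serves twice: a rational series
  without a pole at 0 has a positive radius of convergence, so \<open>1 / d\<close> lies inside it
  for all large \<open>d\<close>, and it supplies the quotient of polynomials that
  \<open>has_formal_expansion\<close> asks for.

  The powers of 2 arise because the expansion variable is \<open>1 / d\<close> while a solid step
  costs \<open>1 / (2 d)\<close>.\<close>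

section \<open>Rational power series and expansion at infinity\<close>

text \<open>The rational functions without a pole at 0: the condition on \<open>Q\<close> makes
  \<open>fps_of_poly Q\<close> a unit of the ring of power series, so the quotient can be expressed
  by a product.\<close>

definition rational_fps :: "'a::field fps \<Rightarrow> bool" where
  "rational_fps F \<longleftrightarrow>
     (\<exists>P Q. coeff Q 0 \<noteq> 0 \<and> F * fps_of_poly Q = fps_of_poly P)"

lemma rational_fps_fps_of_poly: "rational_fps (fps_of_poly P)"
  unfolding rational_fps_def by (intro exI[of _ P] exI[of _ 1]) simp

lemma rational_fps_add:
  assumes "rational_fps F" "rational_fps G"
  shows "rational_fps (F + G)"
proof -
  from assms obtain P Q R S where
    *: "coeff Q 0 \<noteq> 0" "F * fps_of_poly Q = fps_of_poly P"
    "coeff S 0 \<noteq> 0" "G * fps_of_poly S = fps_of_poly R"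
    unfolding rational_fps_def by blast
  have "coeff (Q * S) 0 \<noteq> 0"
    and "(F + G) * fps_of_poly (Q * S) = fps_of_poly (P * S + R * Q)"
  proof -
    have "(F + G) * fps_of_poly (Q * S) =
        (F * fps_of_poly Q) * fps_of_poly S + (G * fps_of_poly S) * fps_of_poly Q"
      by (simp add: fps_of_poly_mult algebra_simps)
    then show "(F + G) * fps_of_poly (Q * S) = fps_of_poly (P * S + R * Q)"
      using * by (simp add: fps_of_poly_mult fps_of_poly_add)
  qed (use * in \<open>simp add: coeff_mult_0\<close>)
  then show ?thesis unfolding rational_fps_def by blast
qed

lemma rational_fps_mult:
  assumes "rational_fps F" "rational_fps G"
  shows "rational_fps (F * G)"
proof -
  from assms obtain P Q R S where
    *: "coeff Q 0 \<noteq> 0" "F * fps_of_poly Q = fps_of_poly P"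
    "coeff S 0 \<noteq> 0" "G * fps_of_poly S = fps_of_poly R"
    unfolding rational_fps_def by blast
  have "coeff (Q * S) 0 \<noteq> 0"
    and "(F * G) * fps_of_poly (Q * S) = fps_of_poly (P * R)"
  proof -
    have "(F * G) * fps_of_poly (Q * S) = (F * fps_of_poly Q) * (G * fps_of_poly S)"
      by (simp add: fps_of_poly_mult algebra_simps)
    then show "(F * G) * fps_of_poly (Q * S) = fps_of_poly (P * R)"
      using * by (simp add: fps_of_poly_mult)
  qed (use * in \<open>simp add: coeff_mult_0\<close>)
  then show ?thesis unfolding rational_fps_def by blast
qed

lemma rational_fps_sum: "(\<And>x. x \<in> A \<Longrightarrow> rational_fps (f x)) \<Longrightarrow> rational_fps (sum f A)"
  by (induction A rule: infinite_finite_induct)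
     (auto simp: rational_fps_add intro: rational_fps_fps_of_poly[of 0, simplified])

lemma rational_fps_inverse:
  assumes "rational_fps F" "fps_nth F 0 \<noteq> 0"
  shows "rational_fps (inverse F)"
proof -
  from assms(1) obtain P Q where *: "coeff Q 0 \<noteq> 0" "F * fps_of_poly Q = fps_of_poly P"
    unfolding rational_fps_def by blast
  have "coeff P 0 = fps_nth F 0 * coeff Q 0"
    using arg_cong[OF *(2), of "\<lambda>F. fps_nth F 0"] by simp
  moreover have "inverse F * fps_of_poly P = fps_of_poly Q"
    using inverse_mult_eq_1[OF assms(2)] by (simp flip: *(2) mult.assoc)
  ultimately show ?thesis
    using * assms(2) unfolding rational_fps_def by (metis no_zero_divisors)
qed

text \<open>For cancelling the power of the variable in a path series once its first coefficients
  are known to vanish. Discarding low coefficients of the numerator again gives a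
  polynomial.\<close>

lemma rational_fps_shift:
  assumes "rational_fps (fps_X ^ n * F)"
  shows "rational_fps F"
proof -
  from assms obtain P Q where
    *: "coeff Q 0 \<noteq> 0" "fps_X ^ n * (F * fps_of_poly Q) = fps_of_poly P"
    unfolding rational_fps_def by (auto simp: mult.assoc)
  have "F * fps_of_poly Q = fps_shift n (fps_X ^ n * (F * fps_of_poly Q))"
    using fps_shift_times_fps_X_power'[of n "F * fps_of_poly Q"] by (simp add: mult.commute)
  also have "\<dots> = fps_of_poly (poly_shift n P)"
    by (simp add: *(2))
  finally show ?thesis using *(1) unfolding rational_fps_def by blast
qed

text \<open>Gaussian elimination: every pivot has constant term one.\<close>

lemma rational_fps_linear_system:
  fixes F :: "'b \<Rightarrow> 'a::field fps"
  assumes "finite S"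
    and "\<And>s t. s \<in> S \<Longrightarrow> t \<in> S \<Longrightarrow> rational_fps (c s t)"
    and "\<And>s. s \<in> S \<Longrightarrow> rational_fps (b s)"
    and "\<And>s. s \<in> S \<Longrightarrow> F s = fps_X * (\<Sum>t\<in>S. c s t * F t) + b s"
    and "s \<in> S"
  shows "rational_fps (F s)"
  using assms
proof (induction S arbitrary: c b s rule: finite_induct)
  case empty
  then show ?case by simp
next
  case (insert z S)
  have X: "rational_fps (fps_X :: 'a fps)"
    using rational_fps_fps_of_poly[of "[:0, 1:]"] by simp
  define w where "w = inverse (1 - fps_X * c z z)"
  have w_inv: "w * (1 - fps_X * c z z) = 1"
    unfolding w_def by (rule inverse_mult_eq_1) simp
  have "rational_fps (1 + fps_of_poly (-1) * (fps_X * c z z))"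
    using rational_fps_fps_of_poly[of 1] X insert.prems(1)[of z z]
    by (intro rational_fps_add rational_fps_mult rational_fps_fps_of_poly) auto
  then have w: "rational_fps w"
    unfolding w_def by (intro rational_fps_inverse) (simp_all add: fps_of_poly_uminus)
  define F' where "F' = (\<Sum>t\<in>S. c z t * F t)"
  have Fz: "F z = w * (fps_X * F' + b z)"
  proof -
    have "F z * (1 - fps_X * c z z) = fps_X * F' + b z"
      using insert.prems(3)[of z] insert.hyps by (simp add: F'_def algebra_simps)
    then have "w * (F z * (1 - fps_X * c z z)) = w * (fps_X * F' + b z)" by simp
    then show ?thesis using w_inv by (metis mult.left_commute mult.right_neutral)
  qed
  \<comment> \<open>Substituting the solved \<open>F z\<close> into the equation of \<open>s\<close>
    keeps the factor \<open>fps_X\<close> in front of the unknowns, so the reduced system has the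
    same shape and its next pivot is again invertible.\<close>
  define c' where "c' = (\<lambda>s t. c s t + fps_X * c s z * w * c z t)"
  define b' where "b' = (\<lambda>s. b s + fps_X * c s z * w * b z)"
  have eq: "F s = fps_X * (\<Sum>t\<in>S. c' s t * F t) + b' s" if "s \<in> S" for s
  proof -
    have "F s = fps_X * (c s z * F z + (\<Sum>t\<in>S. c s t * F t)) + b s"
      using insert.prems(3)[of s] insert.hyps that by simp
    also have "\<dots> = fps_X * ((\<Sum>t\<in>S. c s t * F t) + fps_X * c s z * w * F') + b' s"
      by (simp add: Fz b'_def algebra_simps)
    also have "(\<Sum>t\<in>S. c s t * F t) + fps_X * c s z * w * F' = (\<Sum>t\<in>S. c' s t * F t)"
      by (simp add: c'_def F'_def sum.distrib sum_distrib_left algebra_simps)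
    finally show ?thesis .
  qed
  have IH: "rational_fps (F s)" if "s \<in> S" for s
  proof (rule insert.IH[of c' b' s])
    show "rational_fps (c' s t)" if "s \<in> S" "t \<in> S" for s t
      unfolding c'_def using that w X insert.prems(1)
      by (intro rational_fps_add rational_fps_mult) auto
    show "rational_fps (b' s)" if "s \<in> S" for s
      unfolding b'_def using that w X insert.prems(1,2)
      by (intro rational_fps_add rational_fps_mult) auto
  qed (fact eq that)+
  have "rational_fps (F z)"
    unfolding Fz F'_def using IH w X insert.prems(1,2)
    by (intro rational_fps_add rational_fps_mult rational_fps_sum) auto
  then show ?case using IH insert.prems(4) by auto
qed

text \<open>The denominator does not vanish at 0, so its inverse converges near 0. This is what
  turns a formal series into numbers at \<open>1 / d\<close> for large \<open>d\<close>.\<close>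

lemma rational_fps_conv_radius_pos:
  fixes F :: "real fps"
  assumes "rational_fps F"
  shows "fps_conv_radius F > 0"
proof -
  from assms obtain P Q where *: "coeff Q 0 \<noteq> 0" "F * fps_of_poly Q = fps_of_poly P"
    unfolding rational_fps_def by blast
  have Q: "fps_nth (fps_of_poly Q) 0 \<noteq> 0" using *(1) by simp
  have "F = fps_of_poly P * inverse (fps_of_poly Q)"
    using inverse_mult_eq_1'[OF Q] by (simp flip: *(2) add: mult.assoc)
  moreover have "fps_conv_radius (inverse (fps_of_poly Q)) > 0"
    using Q by (intro fps_conv_radius_inverse_pos) auto
  ultimately show ?thesis
    using fps_conv_radius_mult[of "fps_of_poly P" "inverse (fps_of_poly Q)"]
    by (auto simp: min_def split: if_splits)
qed

lemma eventually_inverse_in_conv_radius: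
  fixes F :: "real fps"
  assumes "fps_conv_radius F > 0"
  shows "\<forall>\<^sub>F d in sequentially. ereal (norm (inverse (real d))) < fps_conv_radius F"
proof -
  have "(\<lambda>d. ereal (norm (inverse (real d)))) \<longlonglongrightarrow> ereal (norm (0::real))"
    by (intro tendsto_ereal tendsto_norm lim_inverse_n)
  moreover have "ereal (norm (0::real)) < fps_conv_radius F"
    using assms by (simp add: zero_ereal_def)
  ultimately show ?thesis by (rule order_tendstoD(2))
qed

section \<open>Change of variable from \<open>1 / d\<close> to \<open>d\<close>\<close>

lemma poly_at_infinity_mult: "poly_at_infinity (p * q) = poly_at_infinity p * poly_at_infinity q"
proof -
  have const_sum: "fls_const (sum f S) = (\<Sum>x\<in>S. fls_const (f x))"
    for f :: "nat \<Rightarrow> real" and S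
    by (induction S rule: infinite_finite_induct) (simp_all flip: fls_plus_const)
  have "map_poly fls_const (p * q) = map_poly fls_const p * map_poly (fls_const :: real \<Rightarrow> _) q"
    by (intro poly_eqI) (simp add: coeff_map_poly coeff_mult const_sum)
  then show ?thesis by (simp add: poly_at_infinity_def)
qed

lemma poly_fls_const_fls_X: "poly (map_poly fls_const p) fls_X = fps_to_fls (fps_of_poly p)"
  for p :: "real poly"
  by (induction p) (simp_all add: map_poly_pCons fps_of_poly_pCons fls_plus_const fls_times_fps_to_fls mult.commute)

text \<open>Reflection is the substitution of the inverse variable up to a power of it, and
  \<open>poly_at_infinity\<close> substitutes the inverse once more, so \<open>p\<close> itself
  reappears as a power series.\<close>

lemma poly_at_infinity_reflect_poly:
  "poly_at_infinity (reflect_poly p) = fls_X_inv ^ degree p * fps_to_fls (fps_of_poly p)"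
proof -
  have "map_poly fls_const (reflect_poly p) = reflect_poly (map_poly (fls_const :: real \<Rightarrow> _) p)"
    by (intro poly_eqI) (auto simp: coeff_map_poly coeff_reflect_poly degree_map_poly)
  then show ?thesis
    unfolding poly_at_infinity_def
    by (simp add: poly_reflect_poly_nz degree_map_poly fls_inverse_X_inv poly_fls_const_fls_X)
qed

lemma poly_at_infinity_monom: "poly_at_infinity (monom 1 n) = fls_X_inv ^ n"
  by (simp add: poly_at_infinity_def map_poly_monom poly_monom)

lemma has_formal_expansionI:
  assumes rat: "rational_fps (Abs_fps a)"
    and f: "\<forall>\<^sub>F d in sequentially. f d = eval_fps (Abs_fps a) (inverse (real d))"
  shows "has_formal_expansion f a"
proof -
  let ?A = "Abs_fps a"
  from rat obtain P Q where PQ: "coeff Q 0 \<noteq> 0" "?A * fps_of_poly Q = fps_of_poly P"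
    unfolding rational_fps_def by blast
  then have Q0: "Q \<noteq> 0" by auto
  \<comment> \<open>The two monomials are crossed over so that numerator and denominator both carry
    \<open>d\<close> to the power \<open>degree P + degree Q\<close> in front of \<open>P\<close>
    and \<open>Q\<close> at \<open>1 / d\<close>, and these powers cancel.\<close>
  define p where "p = monom 1 (degree Q) * reflect_poly P"
  define q where "q = monom 1 (degree P) * reflect_poly Q"
  have "((\<lambda>d. poly Q (inverse (real d))) \<longlongrightarrow> poly Q 0) sequentially"
    by (intro tendsto_intros lim_inverse_n)
  then have ev: "\<forall>\<^sub>F d in sequentially. poly Q (inverse (real d)) \<noteq> 0"
    using PQ(1) by (intro tendsto_imp_eventually_ne) (auto simp: poly_0_coeff_0)
  have "\<forall>\<^sub>F d in sequentially. f d = poly p (real d) / poly q (real d)"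
    using f ev eventually_gt_at_top[of 0]
      eventually_inverse_in_conv_radius[OF rational_fps_conv_radius_pos[OF rat]]
  proof eventually_elim
    case (elim d)
    have "eval_fps ?A (inverse (real d)) * poly Q (inverse (real d)) = poly P (inverse (real d))"
      using eval_fps_mult[of "inverse (real d)" ?A "fps_of_poly Q"] elim(4) by (simp add: PQ(2))
    with elim(1,2) have "f d = poly P (inverse (real d)) / poly Q (inverse (real d))"
      by (simp add: field_simps)
    with elim(3) show ?case
      by (simp add: p_def q_def poly_monom poly_reflect_poly_nz)
  qed
  moreover have "q \<noteq> 0" using Q0 by (simp add: q_def)
  moreover have "poly_at_infinity p / poly_at_infinity q = fps_to_fls ?A"
  proof -
    have "fps_to_fls (fps_of_poly P) = fps_to_fls ?A * fps_to_fls (fps_of_poly Q)"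
      by (simp flip: PQ(2) add: fls_times_fps_to_fls)
    moreover have "fps_to_fls (fps_of_poly Q) \<noteq> 0"
      using Q0 by (simp add: fps_of_poly_eq_iff[of Q 0, simplified])
    ultimately show ?thesis
      by (simp add: p_def q_def poly_at_infinity_mult poly_at_infinity_reflect_poly
          poly_at_infinity_monom field_simps)
  qed
  ultimately show ?thesis unfolding has_formal_expansion_def by blast
qed

section \<open>Pair partitions and paths\<close>

lemma pair_partitionsD:
  assumes "m \<in> pair_partitions k"
  shows "\<Union>m = {1..2 * k}"
    and "\<And>b c x. b \<in> m \<Longrightarrow> c \<in> m \<Longrightarrow> x \<in> b \<Longrightarrow> x \<in> c \<Longrightarrow> b = c"
    and "\<And>b. b \<in> m \<Longrightarrow> card b = 2"
  using assms partition_onD1[of "{1..2 * k}" m] partition_onD2[of "{1..2 * k}" m]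
  unfolding pair_partitions_def disjoint_def by blast+

lemma pair_partitions_blockE:
  assumes "m \<in> pair_partitions k" "b \<in> m"
  obtains x y where "b = {x, y}" "x < y" "x \<in> {1..2 * k}" "y \<in> {1..2 * k}"
proof -
  from pair_partitionsD(3)[OF assms] obtain x y where "b = {x, y}" "x \<noteq> y"
    by (auto simp: card_2_iff)
  moreover have "b \<subseteq> {1..2 * k}" using pair_partitionsD(1)[OF assms(1)] assms(2) by blast
  ultimately show thesis using that[of x y] that[of y x] by (cases "x < y") auto
qed

lemma pair_partitions_partner:
  assumes "m \<in> pair_partitions k" "r \<in> {1..2 * k}"
  obtains x where "{r, x} \<in> m" "x \<noteq> r" "x \<in> {1..2 * k}"
proof -
  obtain b where b: "b \<in> m" "r \<in> b"
    using pair_partitionsD(1)[OF assms(1)] assms(2) by blast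
  from pair_partitions_blockE[OF assms(1) b(1)] obtain x y where
    "b = {x, y}" "x < y" "x \<in> {1..2 * k}" "y \<in> {1..2 * k}" .
  then show thesis using b that[of x] that[of y] by (auto simp: insert_commute)
qed

lemma pair_partitions_partner_unique:
  assumes "m \<in> pair_partitions k" "{r, x} \<in> m" "{r, y} \<in> m"
  shows "x = y"
  using pair_partitionsD(2)[OF assms, of r] by (auto simp: doubleton_eq_iff)

lemma pair_partitions_block_neq:
  assumes "m \<in> pair_partitions k" "{x, y} \<in> m"
  shows "x \<noteq> y"
  using pair_partitionsD(3)[OF assms] by auto

lemma pair_partitions_0: "pair_partitions 0 = {{}}"
  by (auto simp: pair_partitions_def partition_on_empty)

lemma pair_partitions_unique_size:
  "m \<in> pair_partitions k \<Longrightarrow> m \<in> pair_partitions l \<Longrightarrow> k = l"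
  using pair_partitionsD(1)[of m k] pair_partitionsD(1)[of m l]
  by (metis card_atLeastAtMost diff_Suc_1 mult_cancel1 One_nat_def zero_neq_numeral add_diff_cancel_right' Suc_eq_plus1)

lemma finite_pair_partitions: "finite (pair_partitions k)"
  unfolding pair_partitions_def using finitely_many_partition_on[of "{1..2 * k}"] by simp

lemma perm_act_in_pair_partitions:
  assumes "m \<in> pair_partitions k" "bij_betw \<sigma> {1..2 * k} {1..2 * k}"
  shows "perm_act \<sigma> m \<in> pair_partitions k"
proof -
  have "inj_on \<sigma> {1..2 * k}" "\<sigma> ` {1..2 * k} = {1..2 * k}"
    using assms(2) by (auto simp: bij_betw_def)
  moreover have "card (\<sigma> ` b) = 2" if "b \<in> m" for b
    using pair_partitions_blockE[OF assms(1) that] assms(2)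
    by (metis calculation(1) card_image inj_on_subset pair_partitionsD(1,3)[OF assms(1)] that Union_upper)
  moreover have "(`) \<sigma> ` m - {{}} = (`) \<sigma> ` m"
    using assms(1) partition_onD3 by (auto simp: pair_partitions_def)
  ultimately show ?thesis
    using assms(1) partition_on_inj_image[of "{1..2 * k}" m \<sigma>]
    by (auto simp: pair_partitions_def perm_act_def)
qed

lemma transpose_act_in_pair_partitions:
  assumes "m \<in> pair_partitions k" "i \<in> {1..2 * k}" "j \<in> {1..2 * k}"
  shows "perm_act (Transposition.transpose i j) m \<in> pair_partitions k"
proof (rule perm_act_in_pair_partitions[OF assms(1)])
  show "bij_betw (Transposition.transpose i j) {1..2 * k} {1..2 * k}"
    using assms(2,3) by (intro bij_betwI[of _ _ _ "Transposition.transpose i j"])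
      (auto simp: Transposition.transpose_def)
qed

lemma perm_act_doubleton: "{x, y} \<in> m \<Longrightarrow> {\<sigma> x, \<sigma> y} \<in> perm_act \<sigma> m"
  unfolding perm_act_def by (rule image_eqI[of _ _ "{x, y}"]) auto

text \<open>The image determines the index: the old partner \<open>x\<close> of
  \<open>2 k - 1\<close> is matched with \<open>i\<close> afterwards. If \<open>x\<close> is
  \<open>i\<close> itself, the image contains \<open>{i, 2 k - 1}\<close>, which no other index can
  produce. Hence counting paths by vertices counts the choices of \<open>i\<close>.\<close>

lemma transpose_act_inj:
  assumes m: "m \<in> pair_partitions k"
    and ij: "i \<in> {1..<2 * k - 1}" "j \<in> {1..<2 * k - 1}"
    and eq: "perm_act (Transposition.transpose i (2 * k - 1)) m =
             perm_act (Transposition.transpose j (2 * k - 1)) m"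
  shows "i = j"
proof (rule ccontr)
  assume ne: "i \<noteq> j"
  let ?q = "2 * k - 1"
  define n where "n = perm_act (Transposition.transpose i ?q) m"
  obtain x where x: "{?q, x} \<in> m" "x \<noteq> ?q"
    using pair_partitions_partner[OF m, of ?q] ij by auto
  have n: "n \<in> pair_partitions k"
    unfolding n_def using ij by (intro transpose_act_in_pair_partitions[OF m]) auto
  have "{i, Transposition.transpose i ?q x} \<in> n"
    using perm_act_doubleton[OF x(1), of "Transposition.transpose i ?q"] by (simp add: n_def)
  moreover have "{j, Transposition.transpose j ?q x} \<in> n"
    using perm_act_doubleton[OF x(1), of "Transposition.transpose j ?q"] unfolding n_def eq by simp
  ultimately show False
    using ne x(2) ij pair_partitions_partner_unique[OF n, of x i j]
      pair_partitions_partner_unique[OF n, of i ?q j] pair_partitions_partner_unique[OF n, of j ?q i]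
    by (auto simp: Transposition.transpose_def insert_commute split: if_splits)
qed

lemma remove_last_block:
  assumes "m \<in> pair_partitions k" "{2 * k - 1, 2 * k} \<in> m"
  shows "m - {{2 * k - 1, 2 * k}} \<in> pair_partitions (k - 1)"
    and "k > 0"
proof -
  let ?b = "{2 * k - 1, 2 * k}"
  \<comment> \<open>For \<open>k = 0\<close> truncated subtraction would make the block the
    singleton \<open>{0}\<close>, and blocks have two elements.\<close>
  show k: "k > 0"
    using pair_partitions_block_neq[OF assms] by auto
  have "\<Union>(m - {?b}) = \<Union>m - ?b"
    using pair_partitionsD(2)[OF assms(1) _ assms(2)] assms(2) by blast
  also have "\<dots> = {1..2 * (k - 1)}"
    using k by (auto simp: pair_partitionsD(1)[OF assms(1)])
  finally have "\<Union>(m - {?b}) = {1..2 * (k - 1)}" .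
  then show "m - {?b} \<in> pair_partitions (k - 1)"
    using assms(1) by (auto simp: pair_partitions_def partition_on_def disjoint_def)
qed

section \<open>Arrows, and the decomposition of paths by their first step\<close>

lemma solid_arrow_iff:
  assumes "m \<in> pair_partitions k"
  shows "solid_arrow m n \<longleftrightarrow>
    (\<exists>i\<in>{1..<2 * k - 1}. n = perm_act (Transposition.transpose i (2 * k - 1)) m)"
proof -
  have "k' = k" if "m \<in> pair_partitions k'" for k'
    using pair_partitions_unique_size that assms by blast
  then show ?thesis using assms unfolding solid_arrow_def by (metis atLeastLessThan_iff)
qed

lemma dashed_arrow_iff:
  assumes "m \<in> pair_partitions k"
  shows "dashed_arrow m n \<longleftrightarrow> {2 * k - 1, 2 * k} \<in> m \<and> n = m - {{2 * k - 1, 2 * k}}"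
proof -
  have "k' = k" if "m \<in> pair_partitions k'" for k'
    using pair_partitions_unique_size that assms by blast
  then show ?thesis using assms unfolding dashed_arrow_def by metis
qed

lemma solid_arrow_pair_partitions:
  assumes "m \<in> pair_partitions k" "solid_arrow m n"
  shows "n \<in> pair_partitions k"
  using assms(2) transpose_act_in_pair_partitions[OF assms(1)]
  unfolding solid_arrow_iff[OF assms(1)] by auto

lemma dashed_arrow_pair_partitions:
  assumes "m \<in> pair_partitions k" "dashed_arrow m n"
  shows "n \<in> pair_partitions (k - 1)" "k > 0"
  using assms remove_last_block[OF assms(1)] unfolding dashed_arrow_iff[OF assms(1)] by auto

lemma not_solid_and_dashed:
  assumes "m \<in> pair_partitions k" "solid_arrow m n" "dashed_arrow m n"
  shows False
  using pair_partitions_unique_size[of n k "k - 1"] solid_arrow_pair_partitions[OF assms(1,2)]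
    dashed_arrow_pair_partitions[OF assms(1,3)] by auto

lemma card_Collect_less_Suc:
  "card {t. t < Suc N \<and> Q t} = (if Q 0 then 1 else 0) + card {t. t < N \<and> Q (Suc t)}"
proof -
  have "{t. t < Suc N \<and> Q t} = (if Q 0 then {0} else {}) \<union> Suc ` {t. t < N \<and> Q (Suc t)}"
    by (auto simp: image_iff less_Suc_eq_0_disj)
  then show ?thesis by (simp add: card_image card_Un_disjoint)
qed

text \<open>Turns the definition by positions into a recursion. The first step has exactly one kind,
  so exactly one of the two counters drops. The guard \<open>l > 0\<close> protects the truncated
  \<open>l - 1\<close>; for the dashed clause the arrow itself forces \<open>k > 0\<close>.\<close>

lemma weingarten_paths_Cons:
  assumes m: "m \<in> pair_partitions k"
  shows "m' # p \<in> weingarten_paths k m l \<longleftrightarrow> m' = m \<and>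
    (k = 0 \<and> l = 0 \<and> p = [] \<or>
     (l > 0 \<and> (\<exists>n. solid_arrow m n \<and> p \<in> weingarten_paths k n (l - 1))) \<or>
     (\<exists>n. dashed_arrow m n \<and> p \<in> weingarten_paths (k - 1) n l))"
proof (cases "l + k")
  case 0
  then show ?thesis
    using m dashed_arrow_pair_partitions[OF m]
    by (auto simp: weingarten_paths_def pair_partitions_0)
next
  case (Suc N)
  note card = card_Collect_less_Suc[of N "\<lambda>t. R ((m' # p) ! t) ((m' # p) ! Suc t)" for R]
  let ?steps = "\<forall>t<N. solid_arrow (p ! t) (p ! Suc t) \<or> dashed_arrow (p ! t) (p ! Suc t)"
  let ?S = "card {t. t < N \<and> solid_arrow (p ! t) (p ! Suc t)}"
  let ?D = "card {t. t < N \<and> dashed_arrow (p ! t) (p ! Suc t)}"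
  let ?base = "length p = N + 1 \<and> p ! N = {} \<and> ?steps"
  have "m' # p \<in> weingarten_paths k m l \<longleftrightarrow>
    m' = m \<and> ?base \<and> (solid_arrow m (p ! 0) \<or> dashed_arrow m (p ! 0)) \<and>
    (if solid_arrow m (p ! 0) then 1 else 0) + ?S = l \<and>
    (if dashed_arrow m (p ! 0) then 1 else 0) + ?D = k"
    unfolding weingarten_paths_def mem_Collect_eq Suc All_less_Suc2 card by auto
  also have "\<dots> \<longleftrightarrow> m' = m \<and> ?base \<and>
    (solid_arrow m (p ! 0) \<and> Suc ?S = l \<and> ?D = k \<or>
     dashed_arrow m (p ! 0) \<and> ?S = l \<and> Suc ?D = k)"
    using not_solid_and_dashed[OF m, of "p ! 0"]
    by (cases "solid_arrow m (p ! 0)"; cases "dashed_arrow m (p ! 0)") simp_all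
  finally have lhs: "m' # p \<in> weingarten_paths k m l \<longleftrightarrow> \<dots>" .
  have solid: "(l > 0 \<and> p \<in> weingarten_paths k n (l - 1)) \<longleftrightarrow>
      ?base \<and> p ! 0 = n \<and> Suc ?S = l \<and> ?D = k" for n
  proof (cases "l > 0")
    case True
    then have "l - 1 + k = N" using Suc by simp
    then show ?thesis using True unfolding weingarten_paths_def by auto
  qed simp
  have dashed: "p \<in> weingarten_paths (k - 1) n l \<longleftrightarrow>
      ?base \<and> p ! 0 = n \<and> ?S = l \<and> Suc ?D = k"
    if "dashed_arrow m n" for n
  proof -
    have "k > 0" using dashed_arrow_pair_partitions[OF m that] by simp
    then have "l + (k - 1) = N" using Suc by simp
    then show ?thesis using \<open>k > 0\<close> unfolding weingarten_paths_def by auto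
  qed
  have a1: "(l > 0 \<and> (\<exists>n. solid_arrow m n \<and> p \<in> weingarten_paths k n (l - 1))) \<longleftrightarrow>
      solid_arrow m (p ! 0) \<and> ?base \<and> Suc ?S = l \<and> ?D = k"
  proof -
    have "(l > 0 \<and> (\<exists>n. solid_arrow m n \<and> p \<in> weingarten_paths k n (l - 1))) \<longleftrightarrow>
        (\<exists>n. solid_arrow m n \<and> (l > 0 \<and> p \<in> weingarten_paths k n (l - 1)))"
      by blast
    also have "\<dots> \<longleftrightarrow> (\<exists>n. solid_arrow m n \<and> (?base \<and> p ! 0 = n \<and> Suc ?S = l \<and> ?D = k))"
      by (intro ex_cong1 conj_cong refl solid)
    also have "\<dots> \<longleftrightarrow> solid_arrow m (p ! 0) \<and> ?base \<and> Suc ?S = l \<and> ?D = k"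
      by blast
    finally show ?thesis .
  qed
  have a2: "(\<exists>n. dashed_arrow m n \<and> p \<in> weingarten_paths (k - 1) n l) \<longleftrightarrow>
      dashed_arrow m (p ! 0) \<and> ?base \<and> ?S = l \<and> Suc ?D = k"
  proof -
    have "(\<exists>n. dashed_arrow m n \<and> p \<in> weingarten_paths (k - 1) n l) \<longleftrightarrow>
        (\<exists>n. dashed_arrow m n \<and> (?base \<and> p ! 0 = n \<and> ?S = l \<and> Suc ?D = k))"
      by (intro ex_cong1 conj_cong refl dashed)
    also have "\<dots> \<longleftrightarrow> dashed_arrow m (p ! 0) \<and> ?base \<and> ?S = l \<and> Suc ?D = k"
      by blast
    finally show ?thesis .
  qed
  have "\<not> (k = 0 \<and> l = 0)" using Suc by auto
  then show ?thesis unfolding lhs a1 a2 by blast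
qed

lemma Nil_notin_weingarten_paths: "[] \<notin> weingarten_paths k m l"
  by (simp add: weingarten_paths_def)

lemma weingarten_paths_hd: "p \<in> weingarten_paths k m l \<Longrightarrow> p ! 0 = m"
  by (simp add: weingarten_paths_def)

lemma weingarten_paths_0: "weingarten_paths 0 {} l = (if l = 0 then {[{}]} else {})"
proof -
  have m: "{} \<in> pair_partitions 0" by (simp add: pair_partitions_0)
  have "p \<in> weingarten_paths 0 {} l \<longleftrightarrow> p = [{}] \<and> l = 0" for p
    using weingarten_paths_Cons[OF m, of "hd p" "tl p" l] Nil_notin_weingarten_paths[of 0 "{}" l]
    by (cases p) (auto simp: solid_arrow_iff[OF m] dashed_arrow_iff[OF m])
  then show ?thesis by auto
qed

lemma weingarten_paths_Suc:
  assumes m: "m \<in> pair_partitions k" and k: "k > 0"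
  shows "weingarten_paths k m l =
    (\<Union>i\<in>(if l = 0 then {} else {1..<2 * k - 1}).
       (#) m ` weingarten_paths k (perm_act (Transposition.transpose i (2 * k - 1)) m) (l - 1)) \<union>
    (if {2 * k - 1, 2 * k} \<in> m
     then (#) m ` weingarten_paths (k - 1) (m - {{2 * k - 1, 2 * k}}) l else {})"
    (is "_ = ?R")
proof -
  have "p \<in> weingarten_paths k m l \<longleftrightarrow> p \<in> ?R" for p
    using weingarten_paths_Cons[OF m, of "hd p" "tl p" l] Nil_notin_weingarten_paths[of k m l] k
    by (cases p) (auto simp: solid_arrow_iff[OF m] dashed_arrow_iff[OF m])
  then show ?thesis by blast
qed

lemma finite_weingarten_paths:
  "m \<in> pair_partitions k \<Longrightarrow> finite (weingarten_paths k m l)"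
proof (induction "l + k" arbitrary: l k m rule: less_induct)
  case less
  show ?case
  proof (cases "k = 0")
    case True
    then show ?thesis using less.prems by (simp add: pair_partitions_0 weingarten_paths_0)
  next
    case False
    show ?thesis
      unfolding weingarten_paths_Suc[OF less.prems False[unfolded neq0_conv]]
      using less.hyps less.prems False remove_last_block[OF less.prems]
        transpose_act_in_pair_partitions[OF less.prems]
      by (auto intro!: finite_imageI)
  qed
qed

text \<open>The possible second vertices are all distinct: by \<open>transpose_act_inj\<close> among
  the solid arrows, and by the number of blocks between a solid and the dashed one. So the union
  over first steps is disjoint and the cardinalities add up.\<close>

lemma card_weingarten_paths_Suc:
  assumes m: "m \<in> pair_partitions k" and k: "k > 0"
  shows "card (weingarten_paths k m l) =
    (\<Sum>i\<in>(if l = 0 then {} else {1..<2 * k - 1}).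
       card (weingarten_paths k (perm_act (Transposition.transpose i (2 * k - 1)) m) (l - 1))) +
    (if {2 * k - 1, 2 * k} \<in> m
     then card (weingarten_paths (k - 1) (m - {{2 * k - 1, 2 * k}}) l) else 0)"
proof -
  define I where "I = (if l = 0 then {} else {1..<2 * k - 1})"
  define n where "n i = perm_act (Transposition.transpose i (2 * k - 1)) m" for i
  define A where "A i = (#) m ` weingarten_paths k (n i) (l - 1)" for i
  define B where "B = (if {2 * k - 1, 2 * k} \<in> m
     then (#) m ` weingarten_paths (k - 1) (m - {{2 * k - 1, 2 * k}}) l else {})"
  have n: "n i \<in> pair_partitions k" if "i \<in> I" for i
    unfolding n_def using that
    by (intro transpose_act_in_pair_partitions[OF m]) (auto simp: I_def split: if_splits)
  have finA: "finite (A i)" if "i \<in> I" for i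
    using n[OF that] by (simp add: A_def finite_weingarten_paths)
  have finB: "finite B"
    using remove_last_block[OF m] by (simp add: B_def finite_weingarten_paths)
  have disj: "A i \<inter> A j = {}" if "i \<in> I" "j \<in> I" "i \<noteq> j" for i j
  proof -
    have "n i \<noteq> n j"
      using transpose_act_inj[OF m, of i j] that by (auto simp: n_def I_def split: if_splits)
    then show ?thesis by (auto simp: A_def dest!: weingarten_paths_hd)
  qed
  have disjB: "(\<Union>i\<in>I. A i) \<inter> B = {}"
  proof -
    have "n i \<noteq> m - {{2 * k - 1, 2 * k}}" if "i \<in> I" "{2 * k - 1, 2 * k} \<in> m" for i
    proof
      assume "n i = m - {{2 * k - 1, 2 * k}}"
      then have "n i \<in> pair_partitions (k - 1)" using remove_last_block(1)[OF m that(2)] by simp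
      then have "k = k - 1" by (rule pair_partitions_unique_size[OF n[OF that(1)]])
      then show False using k by simp
    qed
    then show ?thesis
      by (auto simp: A_def B_def split: if_splits dest!: weingarten_paths_hd)
  qed
  have "card (weingarten_paths k m l) = card ((\<Union>i\<in>I. A i) \<union> B)"
    unfolding weingarten_paths_Suc[OF assms] I_def A_def n_def B_def by simp
  also have "\<dots> = card (\<Union>i\<in>I. A i) + card B"
    using finA finB disjB by (intro card_Un_disjoint) (auto simp: I_def)
  also have "card (\<Union>i\<in>I. A i) = (\<Sum>i\<in>I. card (A i))"
    using finA disj by (intro card_UN_disjoint) (auto simp: I_def)
  finally show ?thesis
    by (simp add: A_def B_def n_def I_def card_image)
qed

section \<open>Components and the minimal number of solid steps\<close>

lemma card_image_le_card_quotient: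
  assumes "finite V" "equiv V r" and inv: "\<And>x y. (x, y) \<in> r \<Longrightarrow> f x = f y"
  shows "card (f ` V) \<le> card (V // r)"
proof -
  have "finite (V // r)"
    using assms(1,2) by (auto intro: finite_quotient simp: equiv_def refl_on_def)
  moreover have "f ` V \<subseteq> (\<lambda>C. f (SOME x. x \<in> C)) ` (V // r)"
  proof
    fix y assume "y \<in> f ` V"
    then obtain x where x: "x \<in> V" "y = f x" by blast
    have "x \<in> r `` {x}" using assms(2) x(1) by (meson Image_singleton_iff equiv_class_self)
    then have "(SOME z. z \<in> r `` {x}) \<in> r `` {x}" by (rule someI)
    then have "f (SOME z. z \<in> r `` {x}) = y" using inv x(2) by auto
    moreover have "r `` {x} \<in> V // r" using x(1) by (rule quotientI)
    ultimately show "y \<in> (\<lambda>C. f (SOME x. x \<in> C)) ` (V // r)" by force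
  qed
  ultimately show ?thesis by (meson card_image_le card_mono finite_imageI le_trans)
qed

text \<open>Labels constant on components: the number of labels bounds the number of components from
  below. This way the components of the modified graphs along a path never have to be
  computed.\<close>

definition component_labelling :: "nat \<Rightarrow> pairing \<Rightarrow> (nat \<Rightarrow> nat) \<Rightarrow> bool" where
  "component_labelling k m f \<longleftrightarrow> (\<forall>x y. {x, y} \<in> base_pairing k \<union> m \<longrightarrow> f x = f y)"

lemma card_component_labelling:
  assumes "component_labelling k m f"
  shows "card (f ` {1..2 * k}) \<le> size (coset_type k m)"
proof -
  define E where "E = {(u, v). {u, v} \<in> base_pairing k \<union> m}"
  define r where "r = {(x, y). x \<in> {1..2 * k} \<and> y \<in> {1..2 * k} \<and> (x, y) \<in> E\<^sup>*}"
  have inv: "f x = f y" if "(x, y) \<in> E\<^sup>*" for x y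
    using that assms by (induction rule: rtrancl_induct) (auto simp: E_def component_labelling_def)
  have "sym E" by (auto simp: E_def sym_def insert_commute)
  then have "sym (E\<^sup>*)" by (rule sym_rtrancl)
  then have eqv: "equiv {1..2 * k} r"
    by (intro equivI) (auto simp: r_def refl_on_def sym_def trans_def)
  have "card (f ` {1..2 * k}) \<le> card ({1..2 * k} // r)"
    using inv by (intro card_image_le_card_quotient[OF _ eqv]) (auto simp: r_def)
  also have "\<dots> = size (coset_type k m)"
    by (simp add: coset_type_def pairing_components_def r_def E_def)
  finally show ?thesis .
qed

text \<open>Identifying the labels of \<open>i\<close> and \<open>j\<close> turns a labelling for the transposed pairing into one
  for the pairing itself.\<close>

lemma component_labelling_transpose:
  assumes f: "component_labelling k (perm_act (Transposition.transpose i j) m) f"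
  defines "h \<equiv> (\<lambda>a. if a = f i then f j else a)"
  shows "component_labelling k m (h \<circ> f)"
    and "finite V \<Longrightarrow> card (f ` V) \<le> Suc (card ((h \<circ> f) ` V))"
proof -
  let ?\<tau> = "Transposition.transpose i j"
  have h: "h (f (?\<tau> x)) = h (f x)" for x
    by (auto simp: h_def Transposition.transpose_def)
  have base: "f x = f y" if "{x, y} \<in> base_pairing k \<or> {x, y} \<in> perm_act ?\<tau> m" for x y
    using f that by (auto simp: component_labelling_def)
  have *: "h (f x) = h (f y)" if "{x, y} \<in> m" for x y
  proof -
    have "f (?\<tau> x) = f (?\<tau> y)"
      using base perm_act_doubleton[OF that] by blast
    then show ?thesis using h[of x] h[of y] by metis
  qed
  then show "component_labelling k m (h \<circ> f)"
    unfolding component_labelling_def comp_apply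
  proof (intro allI impI)
    fix x y assume "{x, y} \<in> base_pairing k \<union> m"
    then show "h (f x) = h (f y)" using base[of x y] *[of x y] by auto
  qed
  assume "finite V"
  have "f ` V \<subseteq> insert (f i) ((h \<circ> f) ` V)"
    by (auto simp: h_def image_iff)
  then have "card (f ` V) \<le> card (insert (f i) ((h \<circ> f) ` V))"
    using \<open>finite V\<close> by (intro card_mono) auto
  also have "\<dots> \<le> Suc (card ((h \<circ> f) ` V))"
    by (rule card_insert_le_m1) auto
  finally show "card (f ` V) \<le> Suc (card ((h \<circ> f) ` V))" .
qed

text \<open>The removed block is also a block of the base pairing, so it is a component by itself
  and may receive a fresh label.\<close>

lemma component_labelling_add_block:
  assumes m: "m \<in> pair_partitions k" "{2 * k - 1, 2 * k} \<in> m"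
    and f: "component_labelling (k - 1) (m - {{2 * k - 1, 2 * k}}) f"
  shows "\<exists>g. component_labelling k m g \<and>
    card (g ` {1..2 * k}) = Suc (card (f ` {1..2 * (k - 1)}))"
proof -
  let ?b = "{2 * k - 1, 2 * k}"
  have k: "k > 0" using remove_last_block[OF m] by simp
  obtain z where z: "z \<notin> f ` {1..2 * (k - 1)}"
    using ex_new_if_finite[of "f ` {1..2 * (k - 1)}"] by auto
  define g where "g x = (if x \<in> ?b then z else f x)" for x
  have base: "base_pairing k = insert ?b (base_pairing (k - 1))"
  proof -
    have *: "base_pairing j = (\<lambda>r. {2 * r - 1, 2 * r}) ` {1..j}" for j
      unfolding base_pairing_def by blast
    have "{1..k} = insert k {1..k - 1}" using k by auto
    then have "base_pairing k = (\<lambda>r. {2 * r - 1, 2 * r}) ` insert k {1..k - 1}"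
      unfolding * by (rule arg_cong)
    then show ?thesis unfolding * image_insert .
  qed
  have small: "c \<inter> ?b = {}" if "c \<in> base_pairing (k - 1) \<union> (m - {?b})" for c
    using that
  proof
    assume "c \<in> base_pairing (k - 1)"
    then show ?thesis using k by (auto simp: base_pairing_def)
  next
    assume "c \<in> m - {?b}"
    then show ?thesis using pair_partitionsD(2)[OF m(1) _ m(2)] by blast
  qed
  have "g x = g y" if "{x, y} \<in> base_pairing k \<union> m" for x y
  proof (cases "{x, y} = ?b")
    case True
    then show ?thesis by (auto simp: g_def doubleton_eq_iff)
  next
    case False
    then have xy: "{x, y} \<in> base_pairing (k - 1) \<union> (m - {?b})" using that base by auto
    with f have "f x = f y" by (auto simp: component_labelling_def)
    then show ?thesis using small[OF xy] by (auto simp: g_def)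
  qed
  moreover have "g ` {1..2 * k} = insert z (f ` {1..2 * (k - 1)})"
  proof -
    have V: "{1..2 * k} = ?b \<union> {1..2 * (k - 1)}" using k by auto
    have "g ` {1..2 * (k - 1)} = f ` {1..2 * (k - 1)}"
      using k by (intro image_cong) (auto simp: g_def)
    moreover have "g ` ?b = {z}" by (simp add: g_def)
    ultimately show ?thesis unfolding V image_Un by simp
  qed
  ultimately show ?thesis using z unfolding component_labelling_def by (intro exI[of _ g]) auto
qed

text \<open>The path is read backwards from the empty pairing: each of the \<open>k\<close> dashed
  steps creates a new label, and each of the \<open>l\<close> solid steps merges at most two labels
  into one.\<close>

lemma weingarten_path_labelling:
  assumes "m \<in> pair_partitions k" "p \<in> weingarten_paths k m l"
  shows "\<exists>f. component_labelling k m f \<and> k \<le> card (f ` {1..2 * k}) + l"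
  using assms
proof (induction p arbitrary: k m l)
  case Nil
  then show ?case by (simp add: Nil_notin_weingarten_paths)
next
  case (Cons m' p)
  note m = Cons.prems(1)
  consider "k = 0"
    | n where "l > 0" "solid_arrow m n" "p \<in> weingarten_paths k n (l - 1)"
    | n where "dashed_arrow m n" "p \<in> weingarten_paths (k - 1) n l"
    using Cons.prems(2) weingarten_paths_Cons[OF m] by blast
  then show ?case
  proof cases
    case 1
    then show ?thesis
      using m by (intro exI[of _ id]) (auto simp: component_labelling_def pair_partitions_0 base_pairing_def)
  next
    case 2
    from 2(2) obtain i where n: "n = perm_act (Transposition.transpose i (2 * k - 1)) m"
      unfolding solid_arrow_iff[OF m] by blast
    from Cons.IH[OF solid_arrow_pair_partitions[OF m 2(2)] 2(3)] obtain f where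
      "component_labelling k n f" "k \<le> card (f ` {1..2 * k}) + (l - 1)" by blast
    then have f: "component_labelling k (perm_act (Transposition.transpose i (2 * k - 1)) m) f"
      "k \<le> card (f ` {1..2 * k}) + (l - 1)" unfolding n .
    define h where "h a = (if a = f i then f (2 * k - 1) else a)" for a
    have "component_labelling k m (h \<circ> f)"
      and "card (f ` {1..2 * k}) \<le> Suc (card ((h \<circ> f) ` {1..2 * k}))"
      using component_labelling_transpose(1)[OF f(1)]
        component_labelling_transpose(2)[OF f(1), of "{1..2 * k}"] unfolding h_def by simp_all
    then show ?thesis using f(2) 2(1) by (intro exI[of _ "h \<circ> f"]) linarith
  next
    case 3
    have b: "{2 * k - 1, 2 * k} \<in> m" "n = m - {{2 * k - 1, 2 * k}}" and k: "k > 0"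
      using 3(1) dashed_arrow_pair_partitions(2)[OF m 3(1)] unfolding dashed_arrow_iff[OF m] by auto
    from Cons.IH[OF dashed_arrow_pair_partitions(1)[OF m 3(1)] 3(2)] obtain f where
      f: "component_labelling (k - 1) n f" "k - 1 \<le> card (f ` {1..2 * (k - 1)}) + l" by blast
    from component_labelling_add_block[OF m b(1) f(1)[unfolded b(2)]] obtain g where
      "component_labelling k m g" "card (g ` {1..2 * k}) = Suc (card (f ` {1..2 * (k - 1)}))" by blast
    then show ?thesis using f(2) k by (intro exI[of _ g]) auto
  qed
qed

lemma weingarten_paths_empty:
  assumes "m \<in> pair_partitions k" "l < pairing_length k m"
  shows "weingarten_paths k m l = {}"
proof (rule ccontr)
  assume "weingarten_paths k m l \<noteq> {}"
  then obtain p where "p \<in> weingarten_paths k m l" by blast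
  from weingarten_path_labelling[OF assms(1) this]
  obtain f where "component_labelling k m f" "k \<le> card (f ` {1..2 * k}) + l" by blast
  with card_component_labelling[of k m f] have "k \<le> size (coset_type k m) + l" by linarith
  then show False using assms(2) by (simp add: pairing_length_def)
qed

section \<open>The symplectic group\<close>

text \<open>Row \<open>a\<close> of J has its only non-zero entry in column
  \<open>symp_partner d a\<close>, with value \<open>symp_sign d a\<close>.\<close>

definition symp_partner :: "nat \<Rightarrow> nat \<Rightarrow> nat" where
  "symp_partner d a = (if a < d then a + d else a - d)"

definition symp_sign :: "nat \<Rightarrow> nat \<Rightarrow> complex" where
  "symp_sign d a = (if a < d then 1 else -1)"

lemma symp_partner_less: "a < 2 * d \<Longrightarrow> symp_partner d a < 2 * d"
  by (auto simp: symp_partner_def)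

lemma symp_partner_partner: "a < 2 * d \<Longrightarrow> symp_partner d (symp_partner d a) = a"
  by (auto simp: symp_partner_def)

lemma symp_partner_neq: "a < 2 * d \<Longrightarrow> symp_partner d a \<noteq> a"
  by (auto simp: symp_partner_def)

lemma symp_partner_eq_iff:
  "a < 2 * d \<Longrightarrow> b < 2 * d \<Longrightarrow> symp_partner d a = b \<longleftrightarrow> a = symp_partner d b"
  by (metis symp_partner_partner)

lemma symp_sign_partner: "a < 2 * d \<Longrightarrow> symp_sign d (symp_partner d a) = - symp_sign d a"
  by (auto simp: symp_partner_def symp_sign_def)

lemma symp_sign_simps [simp]:
  "symp_sign d a * symp_sign d a = 1" "symp_sign d a \<noteq> 0"
  "cnj (symp_sign d a) = symp_sign d a"
  by (simp_all add: symp_sign_def)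

lemma bij_betw_symp_partner: "bij_betw (symp_partner d) {..<2 * d} {..<2 * d}"
  by (intro bij_betwI[of _ _ _ "symp_partner d"]) (auto simp: symp_partner_less symp_partner_partner)

lemma symplectic_J_index:
  assumes "a < 2 * d" "b < 2 * d"
  shows "symplectic_J d $$ (a, b) = (if b = symp_partner d a then symp_sign d a else 0)"
  using assms by (auto simp: symplectic_J_def symp_partner_def symp_sign_def)

lemma symplectic_J_carrier: "symplectic_J d \<in> carrier_mat (2 * d) (2 * d)"
  unfolding carrier_mat_def symplectic_J_def by simp

lemma mat_adjoint_index:
  fixes A :: "complex mat"
  assumes "A \<in> carrier_mat n n" "i < n" "j < n"
  shows "mat_adjoint A $$ (i, j) = cnj (A $$ (j, i))"
  using assms unfolding mat_adjoint_def by (auto simp: mat_of_rows_index)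

lemma mat_adjoint_carrier:
  fixes A :: "complex mat"
  assumes "A \<in> carrier_mat n n"
  shows "mat_adjoint A \<in> carrier_mat n n"
  using assms unfolding mat_adjoint_def by (auto simp: mat_of_rows_def)

text \<open>Every row and column of J has a single non-zero entry, so the relation with J links one
  entry of \<open>g\<close> to the conjugate of one other entry, without sums.\<close>

lemma Sp_iff:
  "g \<in> Sp d \<longleftrightarrow> g \<in> carrier_mat (2 * d) (2 * d) \<and>
    (\<forall>a<2 * d. \<forall>b<2 * d. (\<Sum>c<2 * d. g $$ (a, c) * cnj (g $$ (b, c))) = (if a = b then 1 else 0)) \<and>
    (\<forall>a<2 * d. \<forall>b<2 * d.
       - symp_sign d b * g $$ (a, symp_partner d b) = symp_sign d a * cnj (g $$ (symp_partner d a, b)))"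
proof (cases "g \<in> carrier_mat (2 * d) (2 * d)")
  case True
  note J = symplectic_J_carrier[of d] and adj = mat_adjoint_carrier[OF True]
  have "g * mat_adjoint g = 1\<^sub>m (2 * d) \<longleftrightarrow>
    (\<forall>a<2 * d. \<forall>b<2 * d. (g * mat_adjoint g) $$ (a, b) = 1\<^sub>m (2 * d) $$ (a, b))"
    using True adj by (auto simp: mat_eq_iff)
  also have "\<dots> \<longleftrightarrow> (\<forall>a<2 * d. \<forall>b<2 * d.
      (\<Sum>c<2 * d. g $$ (a, c) * cnj (g $$ (b, c))) = (if a = b then 1 else 0))"
  proof (intro all_cong imp_cong refl)
    fix a b assume ab: "a < 2 * d" "b < 2 * d"
    have "(g * mat_adjoint g) $$ (a, b) = (\<Sum>c<2 * d. g $$ (a, c) * mat_adjoint g $$ (c, b))"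
      using True adj ab by (auto simp: scalar_prod_def atLeast0LessThan)
    also have "\<dots> = (\<Sum>c<2 * d. g $$ (a, c) * cnj (g $$ (b, c)))"
      using mat_adjoint_index[OF True _ ab(2)] by (intro sum.cong) auto
    finally show "(g * mat_adjoint g) $$ (a, b) = 1\<^sub>m (2 * d) $$ (a, b) \<longleftrightarrow>
        (\<Sum>c<2 * d. g $$ (a, c) * cnj (g $$ (b, c))) = (if a = b then 1 else 0)"
      using ab by simp
  qed
  finally have unitary: "g * mat_adjoint g = 1\<^sub>m (2 * d) \<longleftrightarrow> \<dots>" .
  have "g * symplectic_J d = symplectic_J d * map_mat cnj g \<longleftrightarrow>
    (\<forall>a<2 * d. \<forall>b<2 * d. (g * symplectic_J d) $$ (a, b) = (symplectic_J d * map_mat cnj g) $$ (a, b))"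
    using True J by (auto simp: mat_eq_iff)
  also have "\<dots> \<longleftrightarrow> (\<forall>a<2 * d. \<forall>b<2 * d. - symp_sign d b * g $$ (a, symp_partner d b) =
      symp_sign d a * cnj (g $$ (symp_partner d a, b)))"
  proof (intro all_cong imp_cong refl)
    fix a b assume ab: "a < 2 * d" "b < 2 * d"
    have "(g * symplectic_J d) $$ (a, b) = (\<Sum>c<2 * d. g $$ (a, c) * symplectic_J d $$ (c, b))"
      using True J ab by (auto simp: scalar_prod_def atLeast0LessThan)
    also have "\<dots> = (\<Sum>c<2 * d. if c = symp_partner d b then - symp_sign d b * g $$ (a, c) else 0)"
      using ab by (intro sum.cong)
        (auto simp: symplectic_J_index symp_partner_partner symp_sign_partner symp_partner_less)
    also have "\<dots> = - symp_sign d b * g $$ (a, symp_partner d b)"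
      using ab by (simp add: sum.delta symp_partner_less)
    finally have 1: "(g * symplectic_J d) $$ (a, b) = \<dots>" .
    have "(symplectic_J d * map_mat cnj g) $$ (a, b) =
        (\<Sum>c<2 * d. symplectic_J d $$ (a, c) * cnj (g $$ (c, b)))"
      using True J ab by (auto simp: scalar_prod_def atLeast0LessThan)
    also have "\<dots> = (\<Sum>c<2 * d. if c = symp_partner d a then symp_sign d a * cnj (g $$ (c, b)) else 0)"
      using ab by (intro sum.cong) (auto simp: symplectic_J_index)
    also have "\<dots> = symp_sign d a * cnj (g $$ (symp_partner d a, b))"
      using ab by (simp add: sum.delta symp_partner_less)
    finally show "(g * symplectic_J d) $$ (a, b) = (symplectic_J d * map_mat cnj g) $$ (a, b) \<longleftrightarrow>
       - symp_sign d b * g $$ (a, symp_partner d b) = symp_sign d a * cnj (g $$ (symp_partner d a, b))"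
      using 1 by simp
  qed
  finally show ?thesis using True unitary unfolding Sp_def by blast
qed (simp add: Sp_def)

lemma SpD:
  assumes "g \<in> Sp d"
  shows "g \<in> carrier_mat (2 * d) (2 * d)"
    and "\<And>a b. a < 2 * d \<Longrightarrow> b < 2 * d \<Longrightarrow>
      (\<Sum>c<2 * d. g $$ (a, c) * cnj (g $$ (b, c))) = (if a = b then 1 else 0)"
    and "\<And>a b. a < 2 * d \<Longrightarrow> b < 2 * d \<Longrightarrow>
      - symp_sign d b * g $$ (a, symp_partner d b) = symp_sign d a * cnj (g $$ (symp_partner d a, b))"
  using assms unfolding Sp_iff by blast+

lemma mat_mult_index:
  fixes A B :: "'a :: semiring_0 mat"
  assumes "A \<in> carrier_mat n n" "B \<in> carrier_mat n n" "i < n" "j < n"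
  shows "(A * B) $$ (i, j) = (\<Sum>c<n. A $$ (i, c) * B $$ (c, j))"
  using assms by (auto simp: scalar_prod_def atLeast0LessThan)

lemma Sp_mult:
  assumes "h \<in> Sp d" "g \<in> Sp d"
  shows "h * g \<in> Sp d"
  unfolding Sp_iff
proof (intro conjI allI impI)
  note h = SpD[OF assms(1)] and g = SpD[OF assms(2)]
  note hg = mat_mult_index[OF h(1) g(1)]
  show "h * g \<in> carrier_mat (2 * d) (2 * d)" using h(1) g(1) by auto
  fix a b assume ab: "a < 2 * d" "b < 2 * d"
  have "(\<Sum>c<2 * d. (h * g) $$ (a, c) * cnj ((h * g) $$ (b, c))) =
      (\<Sum>c<2 * d. \<Sum>x<2 * d. \<Sum>y<2 * d. h $$ (a, x) * cnj (h $$ (b, y)) * (g $$ (x, c) * cnj (g $$ (y, c))))"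
    using ab by (intro sum.cong refl) (simp add: hg sum_product algebra_simps)
  also have "\<dots> = (\<Sum>x<2 * d. \<Sum>y<2 * d. \<Sum>c<2 * d. h $$ (a, x) * cnj (h $$ (b, y)) * (g $$ (x, c) * cnj (g $$ (y, c))))"
    by (subst sum.swap, rule sum.cong[OF refl], rule sum.swap)
  also have "\<dots> = (\<Sum>x<2 * d. \<Sum>y<2 * d. h $$ (a, x) * cnj (h $$ (b, y)) * (if x = y then 1 else 0))"
    by (intro sum.cong refl) (simp add: g(2) flip: sum_distrib_left)
  also have "\<dots> = (\<Sum>x<2 * d. h $$ (a, x) * cnj (h $$ (b, x)))"
    by (intro sum.cong refl) (simp add: if_distrib[of "\<lambda>x. _ * x"] sum.delta cong: if_cong)
  finally show "(\<Sum>c<2 * d. (h * g) $$ (a, c) * cnj ((h * g) $$ (b, c))) = (if a = b then 1 else 0)"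
    using h(2)[OF ab] by simp
  let ?p = "symp_partner d"
  have "- symp_sign d b * (h * g) $$ (a, ?p b) =
      (\<Sum>x<2 * d. h $$ (a, x) * (- symp_sign d b * g $$ (x, ?p b)))"
    unfolding hg[OF ab(1) symp_partner_less[OF ab(2)]] sum_distrib_left
    by (intro sum.cong refl) (simp add: mult_ac)
  also have "\<dots> = (\<Sum>x<2 * d. h $$ (a, x) * (symp_sign d x * cnj (g $$ (?p x, b))))"
    using ab by (intro sum.cong refl) (simp only: g(3) lessThan_iff)
  \<comment> \<open>Reindexing by the partner moves the sign from the entry of \<open>g\<close> to
    that of \<open>h\<close>, where the relation for \<open>h\<close> applies.\<close>
  also have "\<dots> = (\<Sum>x<2 * d. h $$ (a, ?p x) * (symp_sign d (?p x) * cnj (g $$ (?p (?p x), b))))"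
    by (rule sum.reindex_bij_betw[OF bij_betw_symp_partner, symmetric])
  also have "\<dots> = (\<Sum>x<2 * d. (- symp_sign d x * h $$ (a, ?p x)) * cnj (g $$ (x, b)))"
    by (intro sum.cong refl) (simp add: symp_partner_partner symp_sign_partner)
  also have "\<dots> = (\<Sum>x<2 * d. (symp_sign d a * cnj (h $$ (?p a, x))) * cnj (g $$ (x, b)))"
    using ab by (intro sum.cong refl) (simp only: h(3) lessThan_iff)
  also have "\<dots> = symp_sign d a * cnj ((h * g) $$ (?p a, b))"
    unfolding hg[OF symp_partner_less[OF ab(1)] ab(2)] cnj_sum sum_distrib_left
    by (intro sum.cong refl) (simp add: mult_ac)
  finally show "- symp_sign d b * (h * g) $$ (a, ?p b) = symp_sign d a * cnj ((h * g) $$ (?p a, b))" .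
qed

text \<open>Rows are unit vectors. The bound makes all monomials integrable and all moments at most
  1 in modulus, as the contraction argument requires.\<close>

lemma Sp_norm_le_1:
  assumes "g \<in> Sp d" "a < 2 * d" "b < 2 * d"
  shows "cmod (g $$ (a, b)) \<le> 1"
proof -
  have "(cmod (g $$ (a, b)))\<^sup>2 \<le> (\<Sum>c<2 * d. (cmod (g $$ (a, c)))\<^sup>2)"
    using assms(3) by (intro member_le_sum) auto
  also have "\<dots> = 1"
  proof -
    have "complex_of_real (\<Sum>c<2 * d. (cmod (g $$ (a, c)))\<^sup>2) = 1"
      using SpD(2)[OF assms(1,2,2)] by (simp only: of_real_sum complex_norm_square) simp
    then show ?thesis using of_real_eq_1_iff by blast
  qed
  finally show ?thesis using power2_le_imp_le[of "cmod (g $$ (a, b))" 1] by simp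
qed

text \<open>This is the entry at \<open>(b, c)\<close> of the transpose of \<open>g\<close> times J
  times \<open>g\<close>. The relation with J turns one factor into a conjugate, and the sum becomes
  an inner product of two columns; these are orthonormal because a right inverse of a square matrix
  is a left inverse.\<close>

lemma Sp_J_form:
  assumes g: "g \<in> Sp d" and bc: "b < 2 * d" "c < 2 * d"
  shows "(\<Sum>a<2 * d. symp_sign d a * g $$ (a, b) * g $$ (symp_partner d a, c)) =
    (if c = symp_partner d b then symp_sign d b else 0)"
proof -
  let ?p = "symp_partner d"
  note G = SpD[OF g]
  have "g * mat_adjoint g = 1\<^sub>m (2 * d)" using g by (simp add: Sp_def)
  then have "mat_adjoint g * g = 1\<^sub>m (2 * d)"
    using mat_mult_left_right_inverse G(1) mat_adjoint_carrier by blast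
  then have "(mat_adjoint g * g) $$ (?p c, b) = (if ?p c = b then 1 else 0)"
    using bc by (simp add: symp_partner_less)
  then have unit: "(\<Sum>a<2 * d. cnj (g $$ (a, ?p c)) * g $$ (a, b)) = (if ?p c = b then 1 else 0)"
    using bc by (simp add: mat_mult_index[OF mat_adjoint_carrier[OF G(1)] G(1)]
        mat_adjoint_index[OF G(1)] symp_partner_less cong: sum.cong_simp)
  have row: "symp_sign d a * g $$ (?p a, c) = - symp_sign d c * cnj (g $$ (a, ?p c))" if "a < 2 * d" for a
    using arg_cong[OF G(3)[OF that bc(2)], of cnj] by simp
  have "(\<Sum>a<2 * d. symp_sign d a * g $$ (a, b) * g $$ (?p a, c)) =
      (\<Sum>a<2 * d. - symp_sign d c * (cnj (g $$ (a, ?p c)) * g $$ (a, b)))"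
  proof (intro sum.cong refl)
    fix a assume "a \<in> {..<2 * d}"
    then show "symp_sign d a * g $$ (a, b) * g $$ (?p a, c) =
        - symp_sign d c * (cnj (g $$ (a, ?p c)) * g $$ (a, b))"
      using row[of a] by (metis lessThan_iff mult.assoc mult.commute)
  qed
  also have "\<dots> = - symp_sign d c * (if ?p c = b then 1 else 0)"
    unfolding unit[symmetric] by (rule sum_distrib_left[symmetric])
  also have "\<dots> = (if c = ?p b then symp_sign d b else 0)"
    using bc by (auto simp: symp_partner_eq_iff symp_sign_partner symp_partner_partner)
  finally show ?thesis .
qed

text \<open>With at most one non-zero entry in each row, the matrix X sends a row of
  \<open>g\<close> to a multiple of a single row, so differentiating a monomial gives monomials. The
  condition on \<open>cnj (\<epsilon> (\<pi> a))\<close> is skewness, and the one with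
  \<open>symp_sign\<close> says that X J = J times the conjugate of X.\<close>

definition sp_generator :: "nat \<Rightarrow> (nat \<Rightarrow> nat) \<Rightarrow> (nat \<Rightarrow> complex) \<Rightarrow> bool" where
  "sp_generator d \<pi> \<epsilon> \<longleftrightarrow> (\<forall>a<2 * d. \<pi> a < 2 * d \<and> \<pi> (\<pi> a) = a \<and>
     \<pi> (symp_partner d a) = symp_partner d (\<pi> a) \<and> cnj (\<epsilon> (\<pi> a)) = - \<epsilon> a \<and>
     \<epsilon> a * symp_sign d (\<pi> a) = symp_sign d a * cnj (\<epsilon> (symp_partner d a)) \<and>
     (\<epsilon> a = 0 \<or> \<epsilon> a * cnj (\<epsilon> a) = 1))"

text \<open>A generator \<open>X\<close> has the entries \<open>\<epsilon> a\<close> at \<open>(a, \<pi> a)\<close>; it is skew-Hermitian with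
  \<open>X\<^sup>3 = - X\<close>, and \<open>sp_rotation\<close> is \<open>exp (t X)\<close>.\<close>

definition sp_rotation :: "nat \<Rightarrow> (nat \<Rightarrow> nat) \<Rightarrow> (nat \<Rightarrow> complex) \<Rightarrow> real \<Rightarrow> complex mat" where
  "sp_rotation d \<pi> \<epsilon> t = mat (2 * d) (2 * d) (\<lambda>(a, b).
     (if b = a then (if \<epsilon> a = 0 then 1 else of_real (cos t)) else 0) +
     (if b = \<pi> a then of_real (sin t) * \<epsilon> a else 0))"

lemma sp_rotation_in_Sp:
  assumes gen: "sp_generator d \<pi> \<epsilon>"
  shows "sp_rotation d \<pi> \<epsilon> t \<in> Sp d"
  unfolding Sp_iff
proof (intro conjI allI impI)
  let ?R = "sp_rotation d \<pi> \<epsilon> t" and ?p = "symp_partner d" and ?s = "complex_of_real (sin t)"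
  \<comment> \<open>Rows with \<open>\<epsilon> a = 0\<close> are fixed by the exponential: their
    diagonal entry is 1 and not the cosine.\<close>
  define C where "C a = (if \<epsilon> a = 0 then 1 else complex_of_real (cos t))" for a
  have R: "?R $$ (a, b) = (if b = a then C a else 0) + (if b = \<pi> a then ?s * \<epsilon> a else 0)"
    if "a < 2 * d" "b < 2 * d" for a b
    using that by (simp add: sp_rotation_def C_def)
  have gen': "\<pi> a < 2 * d" "\<pi> (\<pi> a) = a" "\<pi> (?p a) = ?p (\<pi> a)" "cnj (\<epsilon> (\<pi> a)) = - \<epsilon> a"
    "\<epsilon> a * symp_sign d (\<pi> a) = symp_sign d a * cnj (\<epsilon> (?p a))"
    "\<epsilon> a = 0 \<or> \<epsilon> a * cnj (\<epsilon> a) = 1" if "a < 2 * d" for a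
    using gen that unfolding sp_generator_def by blast+
  have C_cnj: "cnj (C a) = C a" for a by (simp add: C_def)
  have sc: "?s * ?s = 1 - complex_of_real (cos t) * complex_of_real (cos t)"
  proof -
    have "sin t * sin t = 1 - cos t * cos t"
      using sin_cos_squared_add[of t] by (simp add: power2_eq_square)
    then show ?thesis by (metis of_real_1 of_real_diff of_real_mult)
  qed
  show "?R \<in> carrier_mat (2 * d) (2 * d)" by (simp add: sp_rotation_def)
  fix a b assume ab: "a < 2 * d" "b < 2 * d"
  have "(\<Sum>c<2 * d. ?R $$ (a, c) * cnj (?R $$ (b, c))) =
      (\<Sum>c<2 * d. (if c = a then C a * cnj (?R $$ (b, c)) else 0) +
         (if c = \<pi> a then ?s * \<epsilon> a * cnj (?R $$ (b, c)) else 0))"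
    using ab by (intro sum.cong refl) (simp add: R distrib_right)
  also have "\<dots> = C a * cnj (?R $$ (b, a)) + ?s * \<epsilon> a * cnj (?R $$ (b, \<pi> a))"
    using ab gen'(1)[of a] by (simp add: sum.distrib sum.delta)
  also have "\<dots> = (if a = b then 1 else 0)"
  proof (cases "a = b")
    case True
    have "C a * C a + ?s * \<epsilon> a * (?s * cnj (\<epsilon> a)) = 1"
    proof (cases "\<epsilon> a = 0")
      case False
      then have "?s * \<epsilon> a * (?s * cnj (\<epsilon> a)) = ?s * ?s"
        using gen'(6)[OF ab(1)] by (simp add: mult.left_commute mult.assoc)
      then show ?thesis using False sc by (simp add: C_def)
    qed (simp add: C_def)
    \<comment> \<open>At a fixed point of \<open>\<pi>\<close> both summands sit on the diagonal;
      the mixed terms cancel because \<open>\<epsilon> a\<close> is then purely imaginary.\<close>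
    moreover have "\<pi> a = a \<Longrightarrow> cnj (\<epsilon> a) = - \<epsilon> a" using gen'(4)[OF ab(1)] by simp
    ultimately show ?thesis
      using True ab gen'(1)[of a] by (auto simp: R C_cnj algebra_simps)
  next
    case False
    then have "\<pi> a \<noteq> \<pi> b" using gen'(2) ab by metis
    moreover have "a = \<pi> b \<longleftrightarrow> b = \<pi> a" using gen'(2) ab by metis
    moreover have "\<epsilon> (\<pi> a) = 0 \<longleftrightarrow> \<epsilon> a = 0" using gen'(4)[OF ab(1)] by (metis complex_cnj_zero_iff neg_equal_0_iff_equal)
    ultimately show ?thesis
      using False ab gen'(1)[of a] gen'(4)[OF ab(1)] by (auto simp: R C_cnj) (auto simp: C_def)
  qed
  finally show "(\<Sum>c<2 * d. ?R $$ (a, c) * cnj (?R $$ (b, c))) = (if a = b then 1 else 0)" .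
  have 1: "?p b = a \<longleftrightarrow> b = ?p a" using ab by (simp add: symp_partner_eq_iff)
  have 2: "?p b = \<pi> a \<longleftrightarrow> b = \<pi> (?p a)"
    using ab gen'(1)[OF ab(1)] gen'(3)[OF ab(1)] by (simp add: symp_partner_eq_iff)
  have "\<epsilon> (?p a) = 0 \<longleftrightarrow> \<epsilon> a = 0"
    using gen'(5)[OF ab(1)] by (metis complex_cnj_zero_iff mult_eq_0_iff symp_sign_simps(2))
  then have C: "C (?p a) = C a" by (simp add: C_def)
  have 3: "- symp_sign d (\<pi> (?p a)) * \<epsilon> a = symp_sign d a * cnj (\<epsilon> (?p a))"
    using gen'(1,3,5)[OF ab(1)] by (simp add: symp_sign_partner mult.commute)
  have pa: "?p a < 2 * d" "?p b < 2 * d" using ab by (simp_all add: symp_partner_less)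
  have 4: "- symp_sign d b * (if b = ?p a then C a else 0) =
      symp_sign d a * cnj (if b = ?p a then C a else 0)"
    using ab(1) by (simp add: C_cnj symp_sign_partner)
  have 5: "- symp_sign d b * (if b = \<pi> (?p a) then ?s * \<epsilon> a else 0) =
      symp_sign d a * cnj (if b = \<pi> (?p a) then ?s * \<epsilon> (?p a) else 0)"
    using arg_cong[OF 3, of "\<lambda>x. ?s * x"] by (simp add: algebra_simps)
  show "- symp_sign d b * ?R $$ (a, ?p b) = symp_sign d a * cnj (?R $$ (?p a, b))"
    unfolding R[OF ab(1) pa(2)] R[OF pa(1) ab(2)] 1 2 C complex_cnj_add distrib_left 4 5 ..
qed

section \<open>Haar moments and the Schwinger--Dyson equation\<close>

definition sp_moment :: "complex mat measure \<Rightarrow> nat set \<Rightarrow> (nat \<Rightarrow> nat) \<Rightarrow> (nat \<Rightarrow> nat) \<Rightarrow> complex" where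
  "sp_moment \<mu> A i j = (\<integral>g. (\<Prod>r\<in>A. g $$ (i r, j r)) \<partial>\<mu>)"

lemma sp_moment_cong:
  "(\<And>r. r \<in> A \<Longrightarrow> i r = i' r) \<Longrightarrow> (\<And>r. r \<in> A \<Longrightarrow> j r = j' r) \<Longrightarrow>
    sp_moment \<mu> A i j = sp_moment \<mu> A i' j'"
  unfolding sp_moment_def by (intro Bochner_Integration.integral_cong prod.cong) auto

text \<open>Matrix entries commute, so a permutation of the row indices can be traded for one of the
  column indices.\<close>

lemma sp_moment_reindex:
  assumes "bij_betw \<sigma> A A"
  shows "sp_moment \<mu> A (i \<circ> \<sigma>) (j \<circ> \<sigma>) = sp_moment \<mu> A i j"
  unfolding sp_moment_def
  by (intro Bochner_Integration.integral_cong refl)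
     (simp add: prod.reindex_bij_betw[OF assms, of "\<lambda>r. _ $$ (i r, j r)"])

text \<open>At 0 only a product with exactly one sine factor has a non-zero derivative; this selects
  the terms in which a single row was changed.\<close>

lemma has_real_derivative_sin_power_cos_power:
  "((\<lambda>t::real. sin t ^ p * cos t ^ q) has_real_derivative (if p = 1 then 1 else 0)) (at 0)"
proof -
  have "((\<lambda>t::real. sin t ^ p * cos t ^ q) has_real_derivative
      (of_nat p * sin 0 ^ (p - 1) * cos 0 * cos 0 ^ q +
       sin 0 ^ p * (of_nat q * cos 0 ^ (q - 1) * - sin 0))) (at 0)"
    by (auto intro!: derivative_eq_intros simp: algebra_simps)
  moreover have "of_nat p * sin 0 ^ (p - 1) * cos 0 * cos 0 ^ q +
       sin 0 ^ p * (of_nat q * cos 0 ^ (q - 1) * - sin 0) = (if p = 1 then 1 else (0::real))"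
    by (auto simp: power_0_left)
  ultimately show ?thesis by simp
qed

locale haar_sp =
  fixes d :: nat and \<mu> :: "complex mat measure"
  assumes haar: "haar_probability (2 * d) (Sp d) \<mu>"
begin

sublocale prob_space \<mu>
  using haar by (simp add: haar_probability_def)

lemma space_eq: "space \<mu> = Sp d"
  using haar by (simp add: haar_probability_def)

lemma measurable_eq: "measurable M \<mu> = measurable M (borel_matrices (2 * d) (Sp d))"
  "measurable \<mu> M = measurable (borel_matrices (2 * d) (Sp d)) M"
  using haar by (auto simp: haar_probability_def intro!: measurable_cong_sets)

lemma entry_measurable [measurable]:
  assumes "a < 2 * d" "b < 2 * d"
  shows "(\<lambda>g. g $$ (a, b)) \<in> borel_measurable \<mu>"
proof -
  let ?I = "{..<2 * d} \<times> {..<2 * d}"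
  have "(\<lambda>g. \<lambda>(i, j)\<in>?I. g $$ (i, j)) \<in> measurable \<mu> (PiM ?I (\<lambda>_. borel))"
    unfolding measurable_eq borel_matrices_def
    by (rule measurable_vimage_algebra1) (auto simp: space_PiM)
  then have "(\<lambda>g. (\<lambda>(i, j)\<in>?I. g $$ (i, j)) (a, b)) \<in> borel_measurable \<mu>"
    by (rule measurable_compose) (use assms in \<open>auto intro: measurable_component_singleton\<close>)
  then show ?thesis using assms by simp
qed

lemma mult_measurable:
  assumes h: "h \<in> Sp d"
  shows "(\<lambda>g. h * g) \<in> measurable \<mu> \<mu>"
  unfolding measurable_eq(1) borel_matrices_def
proof (rule measurable_vimage_algebra2)
  show "(\<lambda>g. h * g) \<in> space \<mu> \<rightarrow> Sp d" using Sp_mult[OF h] by (auto simp: space_eq)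
  show "(\<lambda>g. \<lambda>(i, j)\<in>{..<2 * d} \<times> {..<2 * d}. (h * g) $$ (i, j))
      \<in> measurable \<mu> (PiM ({..<2 * d} \<times> {..<2 * d}) (\<lambda>_. borel))"
  proof (rule measurable_restrict)
    fix x assume "x \<in> {..<2 * d} \<times> {..<2 * d}"
    then obtain a b where x: "x = (a, b)" "a < 2 * d" "b < 2 * d" by auto
    have "(\<lambda>g. \<Sum>c<2 * d. h $$ (a, c) * g $$ (c, b)) \<in> borel_measurable \<mu>"
      using x by (intro borel_measurable_sum borel_measurable_times borel_measurable_const entry_measurable) auto
    moreover have "(h * g) $$ (a, b) = (\<Sum>c<2 * d. h $$ (a, c) * g $$ (c, b))" if "g \<in> space \<mu>" for g
      using that x SpD(1)[OF h] SpD(1)[of g] by (intro mat_mult_index) (auto simp: space_eq)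
    ultimately show "(\<lambda>g. case x of (i, j) \<Rightarrow> (h * g) $$ (i, j)) \<in> borel_measurable \<mu>"
      unfolding x by (simp cong: measurable_cong)
  qed
qed

lemma integral_mult_left:
  fixes f :: "complex mat \<Rightarrow> complex"
  assumes "h \<in> Sp d" "f \<in> borel_measurable \<mu>"
  shows "(\<integral>g. f (h * g) \<partial>\<mu>) = (\<integral>g. f g \<partial>\<mu>)"
proof -
  have "distr \<mu> \<mu> (\<lambda>g. h * g) = \<mu>"
    using haar assms(1) by (simp add: haar_probability_def)
  then show ?thesis
    using integral_distr[OF mult_measurable[OF assms(1)] assms(2)] by simp
qed

lemma monomial_measurable:
  assumes "i \<in> A \<rightarrow> {..<2 * d}" "j \<in> A \<rightarrow> {..<2 * d}"
  shows "(\<lambda>g. \<Prod>r\<in>A. g $$ (i r, j r)) \<in> borel_measurable \<mu>"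
  using assms by (intro borel_measurable_prod entry_measurable) auto

lemma monomial_integrable:
  assumes "i \<in> A \<rightarrow> {..<2 * d}" "j \<in> A \<rightarrow> {..<2 * d}"
  shows "integrable \<mu> (\<lambda>g. \<Prod>r\<in>A. g $$ (i r, j r))"
proof (rule integrable_const_bound[where B = 1])
  show "AE g in \<mu>. cmod (\<Prod>r\<in>A. g $$ (i r, j r)) \<le> 1"
  proof (rule AE_I2)
    fix g assume "g \<in> space \<mu>"
    then show "cmod (\<Prod>r\<in>A. g $$ (i r, j r)) \<le> 1"
      using assms unfolding prod_norm[symmetric]
      by (intro prod_le_1) (auto simp: space_eq intro!: Sp_norm_le_1)
  qed
qed (rule monomial_measurable[OF assms])

lemma sp_moment_norm_le_1:
  assumes "i \<in> A \<rightarrow> {..<2 * d}" "j \<in> A \<rightarrow> {..<2 * d}"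
  shows "cmod (sp_moment \<mu> A i j) \<le> 1"
proof -
  have "cmod (sp_moment \<mu> A i j) \<le> (\<integral>g. cmod (\<Prod>r\<in>A. g $$ (i r, j r)) \<partial>\<mu>)"
    unfolding sp_moment_def by (rule integral_norm_bound)
  also have "\<dots> \<le> (\<integral>g. 1 \<partial>\<mu>)"
  proof (rule integral_mono)
    fix g assume "g \<in> space \<mu>"
    then show "cmod (\<Prod>r\<in>A. g $$ (i r, j r)) \<le> 1"
      using assms unfolding prod_norm[symmetric]
      by (intro prod_le_1) (auto simp: space_eq intro!: Sp_norm_le_1)
  qed (use monomial_integrable[OF assms] in auto)
  finally show ?thesis by (simp add: prob_space)
qed

text \<open>The derivative at \<open>t = 0\<close> of the invariance under \<open>exp (t X)\<close> for a generator \<open>X\<close>.\<close>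

theorem schwinger_dyson:
  assumes A: "finite A" and gen: "sp_generator d \<pi> \<epsilon>"
    and ij: "i \<in> A \<rightarrow> {..<2 * d}" "j \<in> A \<rightarrow> {..<2 * d}"
  shows "(\<Sum>r\<in>A. \<epsilon> (i r) * sp_moment \<mu> A (i(r := \<pi> (i r))) j) = 0"
proof -
  define i' where "i' B r = (if r \<in> B then \<pi> (i r) else i r)" for B r
  \<comment> \<open>The number of cosine factors: rows outside \<open>B\<close> on which the
    generator vanishes contribute 1 instead.\<close>
  define n where "n B = card {r \<in> A - B. \<epsilon> (i r) \<noteq> 0}" for B
  define c where "c B = (\<Prod>r\<in>B. \<epsilon> (i r)) * sp_moment \<mu> A (i' B) j" for B
  have \<pi>: "\<pi> a < 2 * d" if "a < 2 * d" for a
    using gen that by (simp add: sp_generator_def)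
  have i': "i' B \<in> A \<rightarrow> {..<2 * d}" for B
    using ij(1) \<pi> by (auto simp: i'_def Pi_iff)
  \<comment> \<open>Every entry of the rotated matrix is a sine term plus a term keeping its row;
    \<open>B\<close> collects the positions where the sine term is chosen when the product is
    multiplied out.\<close>
  have expand: "sp_moment \<mu> A i j =
      (\<Sum>B\<in>Pow A. of_real (sin t ^ card B * cos t ^ n B) * c B)" for t
  proof -
    let ?R = "sp_rotation d \<pi> \<epsilon> t"
    define C where "C r = (if \<epsilon> (i r) = 0 then 1 else complex_of_real (cos t))" for r
    define K where "K B = (\<Prod>r\<in>B. of_real (sin t) * \<epsilon> (i r)) * (\<Prod>r\<in>A - B. C r)" for B
    have K: "K B = of_real (sin t ^ card B * cos t ^ n B) * (\<Prod>r\<in>B. \<epsilon> (i r))" for B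
    proof -
      have "(\<Prod>r\<in>A - B. C r) = (\<Prod>r\<in>{r \<in> A - B. \<epsilon> (i r) \<noteq> 0}. complex_of_real (cos t))"
        unfolding C_def using A by (intro prod.mono_neutral_cong_right) auto
      then show ?thesis by (simp add: K_def prod.distrib n_def)
    qed
    have "sp_moment \<mu> A i j = (\<integral>g. (\<Prod>r\<in>A. (?R * g) $$ (i r, j r)) \<partial>\<mu>)"
      unfolding sp_moment_def
      using integral_mult_left[OF sp_rotation_in_Sp[OF gen] monomial_measurable[OF ij]] by simp
    also have "\<dots> = (\<integral>g. (\<Sum>B\<in>Pow A. K B * (\<Prod>r\<in>A. g $$ (i' B r, j r))) \<partial>\<mu>)"
    proof (rule Bochner_Integration.integral_cong[OF refl])
      fix g assume "g \<in> space \<mu>"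
      then have g: "g \<in> carrier_mat (2 * d) (2 * d)" using SpD(1) by (simp add: space_eq)
      have entry: "(?R * g) $$ (i r, j r) =
          of_real (sin t) * \<epsilon> (i r) * g $$ (\<pi> (i r), j r) + C r * g $$ (i r, j r)" if "r \<in> A" for r
      proof -
        have r: "i r < 2 * d" "j r < 2 * d" using ij that by auto
        have "(?R * g) $$ (i r, j r) = (\<Sum>x<2 * d. ?R $$ (i r, x) * g $$ (x, j r))"
          using g r by (intro mat_mult_index) (auto simp: sp_rotation_def)
        also have "\<dots> = (\<Sum>x<2 * d. (if x = i r then C r * g $$ (x, j r) else 0) +
            (if x = \<pi> (i r) then of_real (sin t) * \<epsilon> (i r) * g $$ (x, j r) else 0))"
          using r by (intro sum.cong refl) (auto simp: sp_rotation_def C_def distrib_right)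
        finally show ?thesis using r \<pi> by (simp add: sum.distrib sum.delta)
      qed
      have "(\<Prod>r\<in>A. (?R * g) $$ (i r, j r)) =
          (\<Sum>B\<in>Pow A. (\<Prod>r\<in>B. of_real (sin t) * \<epsilon> (i r) * g $$ (\<pi> (i r), j r)) *
            (\<Prod>r\<in>A - B. C r * g $$ (i r, j r)))"
        by (simp add: entry prod_add[OF A])
      also have "\<dots> = (\<Sum>B\<in>Pow A. K B * (\<Prod>r\<in>A. g $$ (i' B r, j r)))"
      proof (rule sum.cong[OF refl])
        fix B assume "B \<in> Pow A"
        then have "(\<Prod>r\<in>A. g $$ (i' B r, j r)) =
            (\<Prod>r\<in>A - B. g $$ (i' B r, j r)) * (\<Prod>r\<in>B. g $$ (i' B r, j r))"
          using A by (intro prod.subset_diff) auto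
        also have "(\<Prod>r\<in>A - B. g $$ (i' B r, j r)) = (\<Prod>r\<in>A - B. g $$ (i r, j r))"
          by (intro prod.cong) (auto simp: i'_def)
        also have "(\<Prod>r\<in>B. g $$ (i' B r, j r)) = (\<Prod>r\<in>B. g $$ (\<pi> (i r), j r))"
          by (intro prod.cong) (auto simp: i'_def)
        finally show "(\<Prod>r\<in>B. of_real (sin t) * \<epsilon> (i r) * g $$ (\<pi> (i r), j r)) *
            (\<Prod>r\<in>A - B. C r * g $$ (i r, j r)) = K B * (\<Prod>r\<in>A. g $$ (i' B r, j r))"
          by (simp add: K_def prod.distrib)
      qed
      finally show "(\<Prod>r\<in>A. (?R * g) $$ (i r, j r)) = \<dots>" .
    qed
    also have "\<dots> = (\<Sum>B\<in>Pow A. K B * sp_moment \<mu> A (i' B) j)"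
      unfolding sp_moment_def
      using monomial_integrable[OF i' ij(2)] by (subst Bochner_Integration.integral_sum) auto
    finally show ?thesis by (simp add: K c_def mult.assoc)
  qed
  have "((\<lambda>t. \<Sum>B\<in>Pow A. of_real (sin t ^ card B * cos t ^ n B) * c B) has_vector_derivative
      (\<Sum>B\<in>Pow A. of_real (if card B = 1 then 1 else 0) * c B)) (at 0)"
    by (intro has_vector_derivative_sum has_vector_derivative_mult_left
        has_vector_derivative_of_real has_real_derivative_sin_power_cos_power)
  \<comment> \<open>By invariance the same function of \<open>t\<close> is constant.\<close>
  moreover have "((\<lambda>t. \<Sum>B\<in>Pow A. of_real (sin t ^ card B * cos t ^ n B) * c B)
      has_vector_derivative 0) (at 0)"
    unfolding expand[symmetric] by (rule has_vector_derivative_const)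
  ultimately have "(\<Sum>B\<in>Pow A. of_real (if card B = 1 then 1 else 0) * c B) = 0"
    by (rule vector_derivative_unique_at)
  also have "(\<Sum>B\<in>Pow A. of_real (if card B = 1 then 1 else 0) * c B) = (\<Sum>B\<in>(\<lambda>r. {r}) ` A. c B)"
    using A by (intro sum.mono_neutral_cong_right) (auto simp: card_1_singleton_iff)
  also have "\<dots> = (\<Sum>r\<in>A. \<epsilon> (i r) * sp_moment \<mu> A (i(r := \<pi> (i r))) j)"
  proof -
    have "i' {r} = i(r := \<pi> (i r))" for r by (auto simp: i'_def)
    then show ?thesis by (simp add: sum.reindex c_def)
  qed
  finally show ?thesis .
qed

end

section \<open>The recursion for moments\<close>

text \<open>Compatibility with J forces the partners to be rotated as well, with relative sign
  \<open>\<sigma>\<close>. The hypotheses on \<open>v\<close> make the four indices distinct, so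
  that the two planes do not meet.\<close>

lemma sp_generator_rotation:
  assumes c: "c < 2 * d" and v: "v < 2 * d" and ne: "v \<noteq> c" "v \<noteq> symp_partner d c"
  defines "c' \<equiv> symp_partner d c" and "v' \<equiv> symp_partner d v"
    and "\<sigma> \<equiv> symp_sign d c * symp_sign d v"
  shows "sp_generator d
    (\<lambda>a. if a = c then v else if a = v then c else if a = c' then v' else if a = v' then c' else a)
    (\<lambda>a. if a = c then 1 else if a = v then -1 else if a = c' then \<sigma> else if a = v' then -\<sigma> else 0)"
    (is "sp_generator d ?\<pi> ?\<epsilon>")
  unfolding sp_generator_def
proof (intro allI impI)
  fix a assume a: "a < 2 * d"
  have cv: "c' < 2 * d" "v' < 2 * d" "symp_partner d c' = c" "symp_partner d v' = v"
    "c' \<noteq> c" "v' \<noteq> v" "v \<noteq> c'" "v' \<noteq> c" "v' \<noteq> c'"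
    using c v ne unfolding c'_def v'_def
    by (auto simp: symp_partner_less symp_partner_partner symp_partner_neq) (metis symp_partner_partner)+
  have sg: "symp_sign d c' = - symp_sign d c" "symp_sign d v' = - symp_sign d v"
    using c v by (simp_all add: c'_def v'_def symp_sign_partner)
  have \<sigma>: "cnj \<sigma> = \<sigma>" "\<sigma> * \<sigma> = 1" "\<sigma> * symp_sign d c = symp_sign d v" "\<sigma> * symp_sign d v = symp_sign d c"
    by (simp_all add: \<sigma>_def symp_sign_def)
  consider "a = c" | "a = v" | "a = c'" | "a = v'" | "a \<notin> {c, v, c', v'}" by blast
  then show "?\<pi> a < 2 * d \<and> ?\<pi> (?\<pi> a) = a \<and>
     ?\<pi> (symp_partner d a) = symp_partner d (?\<pi> a) \<and> cnj (?\<epsilon> (?\<pi> a)) = - ?\<epsilon> a \<and>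
     ?\<epsilon> a * symp_sign d (?\<pi> a) = symp_sign d a * cnj (?\<epsilon> (symp_partner d a)) \<and>
     (?\<epsilon> a = 0 \<or> ?\<epsilon> a * cnj (?\<epsilon> a) = 1)"
  proof cases
    case 5
    then have "symp_partner d a \<notin> {c, v, c', v'}"
      using a symp_partner_partner[OF a] cv(3,4) by (auto simp: c'_def v'_def)
    then show ?thesis using 5 a by auto
  qed (use c v ne cv sg \<sigma> in \<open>auto simp: c'_def[symmetric] v'_def[symmetric] mult.commute\<close>)
qed

text \<open>Covers the choice of \<open>v\<close> as the partner of \<open>c\<close>, where the two
  planes of the previous rotation coincide.\<close>

lemma sp_generator_plane:
  assumes "c < 2 * d"
  shows "sp_generator d
    (\<lambda>a. if a \<in> {c, symp_partner d c} then symp_partner d a else a)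
    (\<lambda>a. if a \<in> {c, symp_partner d c} then symp_sign d a else 0)"
  using assms unfolding sp_generator_def
  by (auto simp: symp_partner_less symp_partner_partner symp_sign_partner symp_partner_neq symp_partner_eq_iff)

text \<open>Opposite phases on \<open>c\<close> and its partner: a diagonal generator, under which
  every monomial is an eigenvector.\<close>

lemma sp_generator_torus:
  assumes "c < 2 * d"
  shows "sp_generator d (\<lambda>a. a)
    (\<lambda>a. if a \<in> {c, symp_partner d c} then \<i> * symp_sign d a else 0)"
proof -
  have "\<i> * symp_sign d a * cnj (\<i> * symp_sign d a) = 1" for a
    by (simp add: symp_sign_def)
  then show ?thesis
    using assms unfolding sp_generator_def
    by (auto simp: symp_partner_less symp_partner_partner symp_sign_partner symp_partner_neq
        symp_partner_eq_iff simp del: complex_cnj_mult) (simp_all add: symp_sign_partner)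
qed

text \<open>Closed form of the row indices that \<open>symplectic_index\<close> assigns to the base
  pairing. It does not mention \<open>k\<close>, so the rows that remain after removing the last
  block are those of the smaller moment.\<close>

definition sp_row :: "nat \<Rightarrow> nat \<Rightarrow> nat" where
  "sp_row d r = (if odd r then r - 1 else r - 2 + d)"

lemma sp_row_less: "r \<in> {1..2 * k} \<Longrightarrow> 2 * k \<le> d \<Longrightarrow> sp_row d r < 2 * d"
  by (auto simp: sp_row_def elim!: evenE)

lemma inj_on_sp_row: "2 * k \<le> d \<Longrightarrow> inj_on (sp_row d) {1..2 * k}"
  unfolding inj_on_def sp_row_def by (auto elim!: evenE oddE split: if_splits)

context haar_sp
begin

text \<open>The torus derivative multiplies the moment by its weight, the signed count of
  \<open>c\<close> and its partner among the rows, so a non-zero weight kills the moment.\<close>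

lemma sp_moment_eq_0:
  assumes "finite A" "i \<in> A \<rightarrow> {..<2 * d}" "j \<in> A \<rightarrow> {..<2 * d}" "c < 2 * d"
    and ne: "(\<Sum>r\<in>A. if i r \<in> {c, symp_partner d c} then symp_sign d (i r) else 0) \<noteq> 0"
  shows "sp_moment \<mu> A i j = 0"
proof -
  let ?s = "\<lambda>a. if a \<in> {c, symp_partner d c} then symp_sign d a else 0"
  have "(\<Sum>r\<in>A. (if i r \<in> {c, symp_partner d c} then \<i> * symp_sign d (i r) else 0) * sp_moment \<mu> A i j) = 0"
    using schwinger_dyson[OF assms(1) sp_generator_torus[OF assms(4)] assms(2,3)] by simp
  also have "(\<Sum>r\<in>A. (if i r \<in> {c, symp_partner d c} then \<i> * symp_sign d (i r) else 0) * sp_moment \<mu> A i j) =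
      \<i> * sp_moment \<mu> A i j * (\<Sum>r\<in>A. ?s (i r))"
    unfolding sum_distrib_left by (intro sum.cong refl) auto
  finally show ?thesis using ne by simp
qed

text \<open>For each \<open>v\<close> outside the last pair \<open>{c, c'}\<close>, apply the generator rotating \<open>c\<close> into \<open>v\<close> (and
  \<open>c'\<close> into \<open>v'\<close>) to the rows with \<open>c'\<close> at position \<open>2 k - 1\<close> replaced by \<open>v'\<close>.  Of the resulting terms,
  those containing \<open>c\<close> twice vanish by torus invariance; summing the others over \<open>v\<close> with the
  signs of \<open>v\<close> produces \<open>g\<^sup>T J g\<close> and the transposed moments.\<close>

theorem sp_moment_recursion:
  assumes k: "k > 0" "2 * k \<le> d" and j: "j \<in> {1..2 * k} \<rightarrow> {..<2 * d}"
  shows "2 * of_nat d * sp_moment \<mu> {1..2 * k} (sp_row d) j +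
      (\<Sum>r\<in>{1..<2 * k - 1}.
        sp_moment \<mu> {1..2 * k} (sp_row d) (j \<circ> Transposition.transpose r (2 * k - 1))) =
    (if j (2 * k) = symp_partner d (j (2 * k - 1)) then symp_sign d (j (2 * k - 1)) else 0) *
      sp_moment \<mu> {1..2 * (k - 1)} (sp_row d) j"
proof -
  let ?p = "symp_partner d" and ?sg = "symp_sign d"
  define s t where "s = 2 * k - 1" and "t = 2 * k"
  define A A0 where "A = {1..2 * k}" and "A0 = {1..2 * (k - 1)}"
  define \<beta> where "\<beta> = sp_row d"
  define c where "c = \<beta> t"
  define M where "M i = sp_moment \<mu> A i j" for i
  define N where "N r = sp_moment \<mu> A \<beta> (j \<circ> Transposition.transpose r s)" for r
  have st: "s \<noteq> t" "s \<notin> A0" "t \<notin> A0" "finite A0" and A: "A = insert s (insert t A0)"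
    using k(1) by (auto simp: s_def t_def A_def A0_def)
  have finA: "finite A" by (simp add: A_def)
  have sum_A: "(\<Sum>r\<in>A. f r) = f s + f t + (\<Sum>r\<in>A0. f r)" for f :: "nat \<Rightarrow> complex"
    using st by (simp add: A)
  have jA: "j \<in> A \<rightarrow> {..<2 * d}" using j by (simp add: A_def)
  have \<beta>_less: "\<beta> r < 2 * d" if "r \<in> A" for r
    using that k(2) sp_row_less by (auto simp: A_def \<beta>_def)
  have \<beta>A: "\<beta> \<in> A \<rightarrow> {..<2 * d}" using \<beta>_less by auto
  have c: "c < 2 * d" "?p c < 2 * d" "?p (?p c) = c" "?p c \<noteq> c" "?sg c = -1" "?sg (?p c) = 1"
    and \<beta>s: "\<beta> s = ?p c" and \<beta>t: "\<beta> t = c"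
    using k by (auto simp: c_def \<beta>_def sp_row_def s_def t_def symp_partner_def symp_sign_def)
  have \<beta>_inj: "r = r'" if "\<beta> r = \<beta> r'" "r \<in> A" "r' \<in> A" for r r'
    using inj_onD[OF inj_on_sp_row[OF k(2)]] that by (simp add: \<beta>_def A_def)
  have \<beta>_ne: "\<beta> r \<noteq> c" "\<beta> r \<noteq> ?p c" if "r \<in> A0" for r
    using \<beta>_inj[of r t] \<beta>_inj[of r s] that st by (auto simp: A \<beta>s \<beta>t)
  have rows: "\<beta>(s := a) \<in> A \<rightarrow> {..<2 * d}" if "a < 2 * d" for a
    using \<beta>A that by auto

  \<comment> \<open>The term of the later sum in which \<open>v\<close> is the partner of
    \<open>c\<close>. It is obtained from the plane generator applied to rows having
    \<open>c\<close> at both \<open>s\<close> and \<open>t\<close>.\<close>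
  have swap: "M (\<beta>(s := c, t := ?p c)) = - M \<beta>"
  proof -
    have i: "(\<beta>(s := c)) s = c" "(\<beta>(s := c)) t = c" "\<And>r. r \<in> A0 \<Longrightarrow> (\<beta>(s := c)) r = \<beta> r"
      using st \<beta>t by auto
    let ?i = "\<beta>(s := c)"
    let ?\<pi> = "\<lambda>a. if a \<in> {c, ?p c} then ?p a else a"
    let ?\<epsilon> = "\<lambda>a. if a \<in> {c, ?p c} then ?sg a else 0"
    have "(\<Sum>r\<in>A. ?\<epsilon> (?i r) * M (?i(r := ?\<pi> (?i r)))) = 0"
      unfolding M_def by (rule schwinger_dyson[OF finA sp_generator_plane[OF c(1)] rows[OF c(1)] jA])
    then have "?\<epsilon> (?i s) * M (?i(s := ?\<pi> (?i s))) + ?\<epsilon> (?i t) * M (?i(t := ?\<pi> (?i t))) +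
        (\<Sum>r\<in>A0. ?\<epsilon> (?i r) * M (?i(r := ?\<pi> (?i r)))) = 0"
      unfolding sum_A .
    also have "(\<Sum>r\<in>A0. ?\<epsilon> (?i r) * M (?i(r := ?\<pi> (?i r)))) = 0"
    proof (intro sum.neutral ballI)
      fix r assume r: "r \<in> A0"
      show "?\<epsilon> (?i r) * M (?i(r := ?\<pi> (?i r))) = 0"
        unfolding i(3)[OF r] using \<beta>_ne[OF r] by simp
    qed
    finally have *: "?\<epsilon> (?i s) * M (?i(s := ?\<pi> (?i s))) + ?\<epsilon> (?i t) * M (?i(t := ?\<pi> (?i t))) + 0 = 0" .
    have e: "?\<epsilon> (?i s) = ?sg c" "?\<pi> (?i s) = ?p c" "?\<epsilon> (?i t) = ?sg c" "?\<pi> (?i t) = ?p c"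
      unfolding i by simp_all
    have "?i(s := ?p c) = \<beta>" using \<beta>s by auto
    with *[unfolded e] have "?sg c * M \<beta> + ?sg c * M (\<beta>(s := c, t := ?p c)) = 0" by (simp only: add_0_right)
    then show ?thesis using c(5) by (simp add: add_eq_0_iff)
  qed

  have loop: "?sg v * M (\<beta>(s := ?p v, t := v)) =
      - (M \<beta> + (\<Sum>r\<in>A0. if \<beta> r = ?p v then N r else 0))"
    if v: "v \<in> {..<2 * d} - {c, ?p c}" for v
  proof -
    let ?i = "\<beta>(s := ?p v)" and ?\<sigma> = "?sg c * ?sg v"
    let ?\<pi> = "\<lambda>a. if a = c then v else if a = v then c else if a = ?p c then ?p v
      else if a = ?p v then ?p c else a"
    let ?\<epsilon> = "\<lambda>a. if a = c then 1 else if a = v then -1 else if a = ?p c then ?\<sigma>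
      else if a = ?p v then -?\<sigma> else 0"
    have v': "v < 2 * d" "v \<noteq> c" "v \<noteq> ?p c" "?p v < 2 * d" "?p v \<noteq> v" "?p v \<noteq> c" "?p v \<noteq> ?p c"
      using v c(1-4) by (auto simp: symp_partner_less symp_partner_neq) (metis symp_partner_partner)+
    have i: "?i s = ?p v" "?i t = c" "\<And>r. r \<in> A0 \<Longrightarrow> ?i r = \<beta> r"
      using st \<beta>t by auto
    have iA: "?i \<in> A \<rightarrow> {..<2 * d}" using rows[OF v'(4)] .
    have s_term: "?i(s := ?p c) = \<beta>" using \<beta>s by auto
    have A0_term: "?\<epsilon> (\<beta> r) * M (?i(r := ?\<pi> (\<beta> r))) = (if \<beta> r = ?p v then -?\<sigma> * N r else 0)"
      if r: "r \<in> A0" for r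
    proof -
      consider "\<beta> r = v" | "\<beta> r = ?p v" | "\<beta> r \<noteq> v" "\<beta> r \<noteq> ?p v" by blast
      then show ?thesis
      proof cases
        case 1
        have "M (?i(r := c)) = 0"
          unfolding M_def
        proof (rule sp_moment_eq_0[OF _ _ jA c(1)])
          show "finite A" by (simp add: A_def)
          show "?i(r := c) \<in> A \<rightarrow> {..<2 * d}" using \<beta>_less c(1) v'(4) by (auto simp: Pi_iff)
          have "(\<Sum>x\<in>A0. if (?i(r := c)) x \<in> {c, ?p c} then ?sg ((?i(r := c)) x) else 0) =
              (\<Sum>x\<in>{r}. ?sg c)"
            using st r \<beta>_ne by (intro sum.mono_neutral_cong_right) (auto split: if_splits)
          then show "(\<Sum>x\<in>A. if (?i(r := c)) x \<in> {c, ?p c} then ?sg ((?i(r := c)) x) else 0) \<noteq> 0"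
            unfolding sum_A using st r i v' c(5) by auto
        qed
        then show ?thesis using 1 v' by auto
      next
        case 2
        \<comment> \<open>Position \<open>s\<close> already carries \<open>\<beta> r\<close>, and
          position \<open>r\<close> now receives the old row of \<open>s\<close>: the rows
          \<open>\<beta>\<close> with \<open>r\<close> and \<open>s\<close> exchanged. Reindexing
          moves the exchange to the columns.\<close>
        have "?i(r := ?p c) = \<beta> \<circ> Transposition.transpose r s"
          using 2 \<beta>s r st by (auto simp: Transposition.transpose_def)
        moreover have "bij_betw (Transposition.transpose r s) A A"
          using r by (intro bij_betwI[of _ _ _ "Transposition.transpose r s"])
            (auto simp: Transposition.transpose_def A)
        then have "sp_moment \<mu> A (\<beta> \<circ> Transposition.transpose r s \<circ> Transposition.transpose r s)
            (j \<circ> Transposition.transpose r s) = sp_moment \<mu> A (\<beta> \<circ> Transposition.transpose r s) j"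
          by (rule sp_moment_reindex)
        ultimately have "M (?i(r := ?p c)) = N r"
          by (simp add: M_def N_def o_assoc[symmetric])
        then show ?thesis using 2 v' by simp
      next
        case 3
        then show ?thesis using \<beta>_ne[OF r] by simp
      qed
    qed
    have "(\<Sum>r\<in>A. ?\<epsilon> (?i r) * M (?i(r := ?\<pi> (?i r)))) = 0"
      unfolding M_def by (rule schwinger_dyson[OF finA sp_generator_rotation[OF c(1) v'(1-3)] iA jA])
    then have "?\<epsilon> (?i s) * M (?i(s := ?\<pi> (?i s))) + ?\<epsilon> (?i t) * M (?i(t := ?\<pi> (?i t))) +
        (\<Sum>r\<in>A0. ?\<epsilon> (?i r) * M (?i(r := ?\<pi> (?i r)))) = 0"
      unfolding sum_A .
    also have "(\<Sum>r\<in>A0. ?\<epsilon> (?i r) * M (?i(r := ?\<pi> (?i r)))) =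
        (\<Sum>r\<in>A0. if \<beta> r = ?p v then -?\<sigma> * N r else 0)"
    proof (rule sum.cong[OF refl])
      fix r assume r: "r \<in> A0"
      show "?\<epsilon> (?i r) * M (?i(r := ?\<pi> (?i r))) = (if \<beta> r = ?p v then -?\<sigma> * N r else 0)"
        unfolding i(3)[OF r] by (rule A0_term[OF r])
    qed
    also have "\<dots> = -?\<sigma> * (\<Sum>r\<in>A0. if \<beta> r = ?p v then N r else 0)"
      unfolding sum_distrib_left by (intro sum.cong refl) simp
    also have "?\<epsilon> (?i s) * M (?i(s := ?\<pi> (?i s))) = -?\<sigma> * M \<beta>"
      using v' s_term unfolding i by simp
    also have "?\<epsilon> (?i t) * M (?i(t := ?\<pi> (?i t))) = M (\<beta>(s := ?p v, t := v))"
      unfolding i by simp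
    finally have "M (\<beta>(s := ?p v, t := v)) =
        ?\<sigma> * (M \<beta> + (\<Sum>r\<in>A0. if \<beta> r = ?p v then N r else 0))"
      by (simp add: algebra_simps)
    \<comment> \<open>Multiplication by \<open>?sg v\<close> removes \<open>v\<close> from the sign,
      since \<open>?sg v * ?\<sigma>\<close> is \<open>?sg c\<close>, which is -1.\<close>
    then have "?sg v * M (\<beta>(s := ?p v, t := v)) =
        (?sg v * ?sg v) * ?sg c * (M \<beta> + (\<Sum>r\<in>A0. if \<beta> r = ?p v then N r else 0))"
      by simp
    then show ?thesis by (simp add: c(5))
  qed

  have "(\<Sum>v\<in>{..<2 * d} - {c, ?p c}. ?sg v * M (\<beta>(s := ?p v, t := v))) =
      (\<Sum>v\<in>{..<2 * d} - {c, ?p c}. - (M \<beta> + (\<Sum>r\<in>A0. if \<beta> r = ?p v then N r else 0)))"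
    by (intro sum.cong refl loop)
  also have "\<dots> = - (of_nat (card ({..<2 * d} - {c, ?p c})) * M \<beta> +
      (\<Sum>r\<in>A0. \<Sum>v\<in>{..<2 * d} - {c, ?p c}. if \<beta> r = ?p v then N r else 0))"
    by (simp only: sum_negf sum.distrib sum_constant sum.swap[of _ A0])
  \<comment> \<open>Each \<open>r\<close> gets its transposed moment from exactly one
    \<open>v\<close>, the partner of its row, which is admissible because the rows are
    distinct.\<close>
  also have "(\<Sum>r\<in>A0. \<Sum>v\<in>{..<2 * d} - {c, ?p c}. if \<beta> r = ?p v then N r else 0) = (\<Sum>r\<in>A0. N r)"
  proof (rule sum.cong[OF refl])
    fix r assume r: "r \<in> A0"
    then have br: "\<beta> r < 2 * d" "?p (\<beta> r) < 2 * d" "?p (?p (\<beta> r)) = \<beta> r"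
      using \<beta>_less[of r] A by (auto simp: symp_partner_less symp_partner_partner)
    have "(\<Sum>v\<in>{..<2 * d} - {c, ?p c}. if \<beta> r = ?p v then N r else 0) = (\<Sum>v\<in>{?p (\<beta> r)}. N r)"
    proof (rule sum.mono_neutral_cong_right)
      show "{?p (\<beta> r)} \<subseteq> {..<2 * d} - {c, ?p c}"
        using br \<beta>_ne[OF r] c(3) by auto
    qed (use br in \<open>auto simp: symp_partner_partner\<close>)
    then show "(\<Sum>v\<in>{..<2 * d} - {c, ?p c}. if \<beta> r = ?p v then N r else 0) = N r" by simp
  qed
  also have "complex_of_nat (card ({..<2 * d} - {c, ?p c})) = 2 * of_nat d - 2"
  proof -
    have "card ({..<2 * d} - {c, ?p c}) = 2 * d - 2"
      using c by (subst card_Diff_subset) auto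
    then show ?thesis using k by (simp add: of_nat_diff)
  qed
  finally have V: "(\<Sum>v\<in>{..<2 * d} - {c, ?p c}. ?sg v * M (\<beta>(s := ?p v, t := v))) =
      - ((2 * of_nat d - 2) * M \<beta> + (\<Sum>r\<in>A0. N r))" .

  have "(\<Sum>v<2 * d. ?sg v * M (\<beta>(s := ?p v, t := v))) =
      (\<Sum>v\<in>{c, ?p c}. ?sg v * M (\<beta>(s := ?p v, t := v))) +
      (\<Sum>v\<in>{..<2 * d} - {c, ?p c}. ?sg v * M (\<beta>(s := ?p v, t := v)))"
    using c by (subst sum.subset_diff[of "{c, ?p c}"]) auto
  \<comment> \<open>The term \<open>v = c\<close> is the original moment with sign -1, and the
    partner term equals it by \<open>swap\<close>. Together they complete the factor
    \<open>2 d - 2\<close> to \<open>2 d\<close>.\<close>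
  also have "(\<Sum>v\<in>{c, ?p c}. ?sg v * M (\<beta>(s := ?p v, t := v))) = - 2 * M \<beta>"
  proof -
    have "\<beta>(s := ?p c, t := c) = \<beta>" using \<beta>s \<beta>t by auto
    then show ?thesis using c swap by simp
  qed
  also note V
  also have "- 2 * M \<beta> + - ((2 * of_nat d - 2) * M \<beta> + (\<Sum>r\<in>A0. N r)) =
      - (2 * of_nat d * M \<beta> + (\<Sum>r\<in>A0. N r))"
    by (simp add: algebra_simps)
  finally have total: "(\<Sum>v<2 * d. ?sg v * M (\<beta>(s := ?p v, t := v))) =
      - (2 * of_nat d * M \<beta> + (\<Sum>r\<in>A0. N r))" .

  have js: "j s < 2 * d" "j t < 2 * d" using jA A by auto
  \<comment> \<open>The same sum evaluated under the integral: the factors at \<open>s\<close> and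
    \<open>t\<close> combine to an entry of the J-form, which is constant on the group.\<close>
  have "(\<Sum>v<2 * d. ?sg v * M (\<beta>(s := ?p v, t := v))) =
      (\<integral>g. (\<Sum>v<2 * d. ?sg v * (\<Prod>r\<in>A. g $$ ((\<beta>(s := ?p v, t := v)) r, j r))) \<partial>\<mu>)"
  proof -
    have "integrable \<mu> (\<lambda>g. \<Prod>r\<in>A. g $$ ((\<beta>(s := ?p v, t := v)) r, j r))" if "v < 2 * d" for v
      using that \<beta>A jA by (intro monomial_integrable) (auto simp: symp_partner_less)
    then show ?thesis
      unfolding M_def sp_moment_def by (subst Bochner_Integration.integral_sum) auto
  qed
  also have "\<dots> = (\<integral>g. (if j s = ?p (j t) then ?sg (j t) else 0) * (\<Prod>r\<in>A0. g $$ (\<beta> r, j r)) \<partial>\<mu>)"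
  proof (rule Bochner_Integration.integral_cong[OF refl])
    fix g assume "g \<in> space \<mu>"
    then have g: "g \<in> Sp d" by (simp add: space_eq)
    have "(\<Prod>r\<in>A. g $$ ((\<beta>(s := ?p v, t := v)) r, j r)) =
        g $$ (v, j t) * g $$ (?p v, j s) * (\<Prod>r\<in>A0. g $$ (\<beta> r, j r))" for v
    proof -
      have "(\<Prod>r\<in>A0. g $$ ((\<beta>(s := ?p v, t := v)) r, j r)) = (\<Prod>r\<in>A0. g $$ (\<beta> r, j r))"
        using st by (intro prod.cong) auto
      then show ?thesis using st by (simp add: A)
    qed
    then have "(\<Sum>v<2 * d. ?sg v * (\<Prod>r\<in>A. g $$ ((\<beta>(s := ?p v, t := v)) r, j r))) =
        (\<Sum>v<2 * d. ?sg v * g $$ (v, j t) * g $$ (?p v, j s)) * (\<Prod>r\<in>A0. g $$ (\<beta> r, j r))"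
      unfolding sum_distrib_right by (intro sum.cong refl) (simp add: mult.assoc)
    then show "(\<Sum>v<2 * d. ?sg v * (\<Prod>r\<in>A. g $$ ((\<beta>(s := ?p v, t := v)) r, j r))) =
        (if j s = ?p (j t) then ?sg (j t) else 0) * (\<Prod>r\<in>A0. g $$ (\<beta> r, j r))"
      by (simp only: Sp_J_form[OF g js(2,1)])
  qed
  also have "\<dots> = (if j s = ?p (j t) then ?sg (j t) else 0) * sp_moment \<mu> A0 \<beta> j"
    unfolding sp_moment_def by simp
  \<comment> \<open>The form was read with \<open>t\<close> before \<open>s\<close>; antisymmetry of
    J restores the order and cancels the minus sign of \<open>total\<close>.\<close>
  also have "(if j s = ?p (j t) then ?sg (j t) else 0) = - (if j t = ?p (j s) then ?sg (j s) else 0)"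
    using js by (auto simp: symp_partner_partner symp_sign_partner)
  finally have "2 * of_nat d * M \<beta> + (\<Sum>r\<in>A0. N r) =
      (if j t = ?p (j s) then ?sg (j s) else 0) * sp_moment \<mu> A0 \<beta> j"
    unfolding total mult_minus_left neg_equal_iff_equal .
  moreover have "A0 = {1..<2 * k - 1}" using k by (auto simp: A0_def)
  ultimately show ?thesis
    unfolding M_def N_def \<beta>_def A_def s_def t_def by (simp add: A0_def)
qed

end

section \<open>The Pfaffian sign of the column indices\<close>

text \<open>For injective \<open>\<kappa>\<close> the sign of the permutation sorting its values.
  The factor with \<open>y - x\<close> makes the weight symmetric in the pair, so an element can be
  inserted without regard to its place in the order.\<close>

definition order_sign :: "nat set \<Rightarrow> (nat \<Rightarrow> nat) \<Rightarrow> int" where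
  "order_sign V \<kappa> = (\<Prod>(x, y)\<in>{(x, y). x \<in> V \<and> y \<in> V \<and> x < y}.
     sgn (int y - int x) * sgn (int (\<kappa> y) - int (\<kappa> x)))"

lemma order_sign_cong: "(\<And>x. x \<in> V \<Longrightarrow> \<kappa> x = \<kappa>' x) \<Longrightarrow> order_sign V \<kappa> = order_sign V \<kappa>'"
  unfolding order_sign_def by (intro prod.cong) auto

lemma order_sign_insert:
  assumes "finite V" "a \<notin> V"
  shows "order_sign (insert a V) \<kappa> =
    order_sign V \<kappa> * (\<Prod>x\<in>V. sgn (int a - int x) * sgn (int (\<kappa> a) - int (\<kappa> x)))"
proof -
  let ?w = "\<lambda>(x, y). sgn (int y - int x) * sgn (int (\<kappa> y) - int (\<kappa> x))"
  let ?P = "\<lambda>V. {(x, y). x \<in> V \<and> y \<in> V \<and> x < y}" and ?f = "\<lambda>x. (min x a, max x a)"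
  have P: "?P (insert a V) = ?P V \<union> ?f ` V"
    using assms(2) by (auto simp: min_def max_def image_iff split: if_splits) (metis less_le_not_le nat_less_le)+
  have "finite (?P V)" using assms(1) by (rule_tac finite_subset[of _ "V \<times> V"]) auto
  then have "prod ?w (?P (insert a V)) = prod ?w (?P V) * prod ?w (?f ` V)"
    unfolding P using assms by (intro prod.union_disjoint) (auto simp: min_def max_def split: if_splits)
  also have "prod ?w (?f ` V) = (\<Prod>x\<in>V. ?w (?f x))"
  proof (subst prod.reindex)
    show "inj_on ?f V" using assms(2) by (auto simp: inj_on_def min_def max_def split: if_splits)
  qed simp
  also have "\<dots> = (\<Prod>x\<in>V. sgn (int a - int x) * sgn (int (\<kappa> a) - int (\<kappa> x)))"
  proof (rule prod.cong[OF refl])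
    fix x
    have "sgn (int x - int a) = - sgn (int a - int x)"
      "sgn (int (\<kappa> x) - int (\<kappa> a)) = - sgn (int (\<kappa> a) - int (\<kappa> x))"
      by (simp_all add: sgn_if)
    then show "?w (?f x) = sgn (int a - int x) * sgn (int (\<kappa> a) - int (\<kappa> x))"
      by (simp add: min_def max_def)
  qed
  finally show ?thesis by (simp add: order_sign_def)
qed

lemma order_sign_insert2:
  assumes "finite V" "a \<notin> V" "b \<notin> V" "a \<noteq> b"
  shows "order_sign (insert b (insert a V)) \<kappa> =
    order_sign V \<kappa> * (sgn (int b - int a) * sgn (int (\<kappa> b) - int (\<kappa> a))) *
    (\<Prod>x\<in>V. sgn (int a - int x) * sgn (int b - int x) *
       (sgn (int (\<kappa> a) - int (\<kappa> x)) * sgn (int (\<kappa> b) - int (\<kappa> x))))"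
  using assms by (simp add: order_sign_insert prod.distrib mult_ac)

text \<open>The weights linking \<open>a\<close> and \<open>b\<close> to a third element are merely
  exchanged; only the weight of the pair itself changes sign.\<close>

lemma order_sign_transpose:
  assumes "finite V" "a \<in> V" "b \<in> V" "a \<noteq> b"
  shows "order_sign V (\<kappa> \<circ> Transposition.transpose a b) = - order_sign V \<kappa>"
proof -
  define U where "U = V - {a, b}"
  have V: "V = insert b (insert a U)" and U: "finite U" "a \<notin> U" "b \<notin> U"
    using assms by (auto simp: U_def)
  let ?\<kappa> = "\<kappa> \<circ> Transposition.transpose a b"
  have \<kappa>: "?\<kappa> a = \<kappa> b" "?\<kappa> b = \<kappa> a" "\<And>x. x \<in> U \<Longrightarrow> ?\<kappa> x = \<kappa> x"
    using U by (auto simp: Transposition.transpose_def)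
  have "order_sign U ?\<kappa> = order_sign U \<kappa>"
    by (rule order_sign_cong) (rule \<kappa>(3))
  moreover have "sgn (int (\<kappa> a) - int (\<kappa> b)) = - sgn (int (\<kappa> b) - int (\<kappa> a))"
    by (simp add: sgn_if)
  moreover have "(\<Prod>x\<in>U. sgn (int a - int x) * sgn (int b - int x) *
       (sgn (int (?\<kappa> a) - int (?\<kappa> x)) * sgn (int (?\<kappa> b) - int (?\<kappa> x)))) =
     (\<Prod>x\<in>U. sgn (int a - int x) * sgn (int b - int x) *
       (sgn (int (\<kappa> a) - int (\<kappa> x)) * sgn (int (\<kappa> b) - int (\<kappa> x))))"
    by (intro prod.cong refl) (simp only: \<kappa> mult.commute)
  ultimately show ?thesis
    unfolding V order_sign_insert2[OF U assms(4)] \<kappa>(1,2) by simp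
qed

lemma order_sign_abs:
  assumes "finite V" "inj_on \<kappa> V"
  shows "\<bar>order_sign V \<kappa>\<bar> = 1"
  unfolding order_sign_def abs_prod
  using assms(2) by (intro prod.neutral) (auto simp: abs_mult abs_sgn_eq inj_on_def)

text \<open>Lists the indices as 0, \<open>d\<close>, 1, \<open>d + 1\<close> and so on. In this
  order, removing two partners from the last two positions changes the sign by exactly their
  J-entry.\<close>

definition symp_key :: "nat \<Rightarrow> nat \<Rightarrow> nat" where
  "symp_key d a = (if a < d then 2 * a else 2 * (a - d) + 1)"

lemma inj_on_symp_key: "inj_on (symp_key d) {..<2 * d}"
  unfolding inj_on_def symp_key_def by (auto split: if_splits) presburger+

text \<open>The keys of \<open>a\<close> and its partner are adjacent, so no other key separates them.\<close>

lemma sgn_symp_key_partner: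
  assumes "a < 2 * d" "x < 2 * d" "x \<noteq> a" "x \<noteq> symp_partner d a"
  shows "sgn (int (symp_key d a) - int (symp_key d x)) *
    sgn (int (symp_key d (symp_partner d a)) - int (symp_key d x)) = 1"
proof -
  have "symp_key d a div 2 \<noteq> symp_key d x div 2"
    using assms by (auto simp: symp_key_def symp_partner_def split: if_splits)
  moreover have "symp_key d (symp_partner d a) div 2 = symp_key d a div 2"
    using assms by (auto simp: symp_key_def symp_partner_def)
  ultimately have "symp_key d a < symp_key d x \<and> symp_key d (symp_partner d a) < symp_key d x \<or>
      symp_key d a > symp_key d x \<and> symp_key d (symp_partner d a) > symp_key d x"
    by linarith
  then show ?thesis by (auto simp: sgn_if)
qed

lemma sgn_symp_key_block:
  assumes "a < 2 * d"
  shows "of_int (sgn (int (symp_key d (symp_partner d a)) - int (symp_key d a))) = symp_sign d a"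
  using assms by (auto simp: symp_key_def symp_partner_def symp_sign_def)

text \<open>Either element of a block may carry the lower index. This freedom makes compatibility
  stable under transpositions of positions, and injectivity makes \<open>j\<close> determine the
  pairing.\<close>

definition symp_compatible :: "nat \<Rightarrow> nat \<Rightarrow> pairing \<Rightarrow> (nat \<Rightarrow> nat) \<Rightarrow> bool" where
  "symp_compatible d k m j \<longleftrightarrow> j \<in> {1..2 * k} \<rightarrow> {..<2 * d} \<and> inj_on j {1..2 * k} \<and>
     (\<forall>x y. {x, y} \<in> m \<longrightarrow> j y = symp_partner d (j x))"

lemma symp_compatible_transpose:
  assumes "symp_compatible d k m j" "a \<in> {1..2 * k}" "b \<in> {1..2 * k}"
  shows "symp_compatible d k (perm_act (Transposition.transpose a b) m) (j \<circ> Transposition.transpose a b)"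
proof -
  let ?\<tau> = "Transposition.transpose a b"
  have bij: "bij_betw ?\<tau> {1..2 * k} {1..2 * k}"
    using assms(2,3) by (intro bij_betwI[of _ _ _ ?\<tau>]) (auto simp: Transposition.transpose_def)
  have "j (?\<tau> y) = symp_partner d (j (?\<tau> x))" if "{x, y} \<in> perm_act ?\<tau> m" for x y
  proof -
    from that obtain c where c: "c \<in> m" "{x, y} = ?\<tau> ` c" by (auto simp: perm_act_def)
    have "?\<tau> ` {x, y} = ?\<tau> ` ?\<tau> ` c" unfolding c(2) ..
    then have "{?\<tau> x, ?\<tau> y} = c" by (simp add: image_image)
    then show ?thesis using assms(1) c(1) by (auto simp: symp_compatible_def)
  qed
  moreover have "j \<circ> ?\<tau> \<in> {1..2 * k} \<rightarrow> {..<2 * d}"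
    using assms(1) bij_betwE[OF bij] by (auto simp: symp_compatible_def Pi_iff)
  moreover have "inj_on (j \<circ> ?\<tau>) {1..2 * k}"
    using assms(1) bij by (intro comp_inj_on) (auto simp: symp_compatible_def bij_betw_def)
  ultimately show ?thesis by (auto simp: symp_compatible_def)
qed

lemma symp_compatible_remove:
  assumes "symp_compatible d k m j"
  shows "symp_compatible d (k - 1) (m - b) j"
proof -
  have "{1..2 * (k - 1)} \<subseteq> {1..2 * k}" by auto
  then show ?thesis
    using assms unfolding symp_compatible_def by (blast intro: inj_on_subset)
qed

context haar_sp
begin

definition signed_moment :: "nat \<Rightarrow> (nat \<Rightarrow> nat) \<Rightarrow> complex" where
  "signed_moment k j =
     of_int (order_sign {1..2 * k} (symp_key d \<circ> j)) * sp_moment \<mu> {1..2 * k} (sp_row d) j"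

lemma order_sign_compatible:
  assumes "symp_compatible d k m j"
  shows "\<bar>order_sign {1..2 * k} (symp_key d \<circ> j)\<bar> = 1"
proof (rule order_sign_abs)
  have "j ` {1..2 * k} \<subseteq> {..<2 * d}" using assms by (auto simp: symp_compatible_def)
  then show "inj_on (symp_key d \<circ> j) {1..2 * k}"
    using assms inj_on_subset[OF inj_on_symp_key]
    by (intro comp_inj_on) (auto simp: symp_compatible_def)
qed simp

lemma norm_signed_moment:
  assumes "symp_compatible d k m j"
  shows "cmod (signed_moment k j) = cmod (sp_moment \<mu> {1..2 * k} (sp_row d) j)"
proof -
  have "cmod (of_int (order_sign {1..2 * k} (symp_key d \<circ> j))) = 1"
    using order_sign_compatible[OF assms] by (metis norm_of_int of_int_1 of_int_abs)
  then show ?thesis by (simp add: signed_moment_def norm_mult)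
qed

lemma signed_moment_recursion:
  assumes m: "m \<in> pair_partitions k" and k: "k > 0" "2 * k \<le> d" and j: "symp_compatible d k m j"
  shows "2 * of_nat d * signed_moment k j =
    (\<Sum>r\<in>{1..<2 * k - 1}. signed_moment k (j \<circ> Transposition.transpose r (2 * k - 1))) +
    (if {2 * k - 1, 2 * k} \<in> m then signed_moment (k - 1) j else 0)"
proof -
  define s t where "s = 2 * k - 1" and "t = 2 * k"
  define A A0 where "A = {1..2 * k}" and "A0 = {1..2 * (k - 1)}"
  define \<epsilon> where "\<epsilon> = order_sign A (symp_key d \<circ> j)"
  let ?M = "sp_moment \<mu> A (sp_row d)" and ?p = "symp_partner d"
  have st: "s \<noteq> t" "s \<notin> A0" "t \<notin> A0" "finite A0" and A: "A = insert t (insert s A0)"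
    using k(1) by (auto simp: s_def t_def A_def A0_def)
  have jA: "j \<in> A \<rightarrow> {..<2 * d}" "inj_on j A" and jm: "\<And>x y. {x, y} \<in> m \<Longrightarrow> j y = ?p (j x)"
    using j by (auto simp: symp_compatible_def A_def)
  have rec: "2 * of_nat d * ?M j + (\<Sum>r\<in>{1..<s}. ?M (j \<circ> Transposition.transpose r s)) =
      (if j t = ?p (j s) then symp_sign d (j s) else 0) * sp_moment \<mu> A0 (sp_row d) j"
    using sp_moment_recursion[OF k] jA unfolding A_def A0_def s_def t_def by blast
  have "signed_moment k (j \<circ> Transposition.transpose r s) = - (of_int \<epsilon> * ?M (j \<circ> Transposition.transpose r s))"
    if "r \<in> {1..<s}" for r
  proof -
    have "order_sign A (symp_key d \<circ> j \<circ> Transposition.transpose r s) = - \<epsilon>"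
      unfolding \<epsilon>_def by (rule order_sign_transpose) (use that in \<open>auto simp: A_def s_def\<close>)
    then show ?thesis by (simp add: signed_moment_def A_def o_assoc)
  qed
  then have sum: "(\<Sum>r\<in>{1..<s}. signed_moment k (j \<circ> Transposition.transpose r s)) =
      - (of_int \<epsilon> * (\<Sum>r\<in>{1..<s}. ?M (j \<circ> Transposition.transpose r s)))"
    by (simp add: sum_distrib_left sum_negf)
  have "of_int \<epsilon> * ((if j t = ?p (j s) then symp_sign d (j s) else 0) * sp_moment \<mu> A0 (sp_row d) j) =
      (if {s, t} \<in> m then signed_moment (k - 1) j else 0)"
  proof (cases "{s, t} \<in> m")
    case True
    have js: "j s < 2 * d" using jA(1) A by auto
    have jt: "j t = ?p (j s)" using jm[OF True] .
    \<comment> \<open>The last two positions are split off. Their weights with every earlier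
      position cancel, because their keys are adjacent, and the sign of their own pair
      remains.\<close>
    have "order_sign A (symp_key d \<circ> j) = order_sign A0 (symp_key d \<circ> j) *
        (sgn (int t - int s) * sgn (int (symp_key d (j t)) - int (symp_key d (j s)))) *
        (\<Prod>x\<in>A0. sgn (int s - int x) * sgn (int t - int x) *
          (sgn (int (symp_key d (j s)) - int (symp_key d (j x))) *
           sgn (int (symp_key d (j t)) - int (symp_key d (j x)))))"
      unfolding A using st by (subst order_sign_insert2) auto
    also have "(\<Prod>x\<in>A0. sgn (int s - int x) * sgn (int t - int x) *
          (sgn (int (symp_key d (j s)) - int (symp_key d (j x))) *
           sgn (int (symp_key d (j t)) - int (symp_key d (j x))))) = 1"
    proof (rule prod.neutral, rule ballI)
      fix x assume x: "x \<in> A0"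
      have "j x < 2 * d" using jA(1) x A by auto
      moreover have "j x \<noteq> j s" "j x \<noteq> ?p (j s)"
        using inj_onD[OF jA(2), of x s] inj_onD[OF jA(2), of x t] x st jt by (auto simp: A)
      moreover have "x < s" "x < t" using x by (auto simp: A0_def s_def t_def)
      ultimately show "sgn (int s - int x) * sgn (int t - int x) *
          (sgn (int (symp_key d (j s)) - int (symp_key d (j x))) *
           sgn (int (symp_key d (j t)) - int (symp_key d (j x)))) = 1"
        using sgn_symp_key_partner[OF js, of "j x"] unfolding jt by simp
    qed
    also have "sgn (int t - int s) = 1" using k by (simp add: s_def t_def)
    \<comment> \<open>The J-entry thus occurs both here and in the recursion for moments, and its
      square is 1.\<close>
    finally have "of_int \<epsilon> = of_int (order_sign A0 (symp_key d \<circ> j)) * symp_sign d (j s)"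
      unfolding \<epsilon>_def jt using sgn_symp_key_block[OF js] by (simp add: comp_def)
    then show ?thesis using True jt by (simp add: signed_moment_def A0_def)
  next
    case False
    \<comment> \<open>Without the block, the partner of index \<open>j s\<close> sits at a position
      other than \<open>t\<close>, so by injectivity the J-entry on the right vanishes.\<close>
    have "s \<in> {1..2 * k}" using k by (auto simp: s_def)
    then obtain x where x: "{s, x} \<in> m" "x \<noteq> s" "x \<in> A"
      using pair_partitions_partner[OF m] unfolding A_def by blast
    then have "x \<noteq> t" using False by auto
    then have "j x \<noteq> j t" using inj_onD[OF jA(2), of x t] x(3) by (auto simp: A)
    then show ?thesis using False jm[OF x(1)] by auto
  qed
  then have "2 * of_nat d * (of_int \<epsilon> * ?M j) + of_int \<epsilon> * (\<Sum>r\<in>{1..<s}. ?M (j \<circ> Transposition.transpose r s)) =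
      (if {s, t} \<in> m then signed_moment (k - 1) j else 0)"
    unfolding rec[symmetric] by (simp add: algebra_simps)
  then show ?thesis
    using sum unfolding s_def t_def signed_moment_def[of k j] \<epsilon>_def A_def by (simp add: algebra_simps)
qed

end

section \<open>Generating functions of paths\<close>

text \<open>The variable stands for \<open>1 / d\<close>, as in \<open>has_formal_expansion\<close>;
  hence the division by a power of 2.\<close>

definition path_fps :: "nat \<Rightarrow> pairing \<Rightarrow> real fps" where
  "path_fps k m = Abs_fps (\<lambda>l. real (card (weingarten_paths k m l)) / 2 ^ l)"

lemma path_fps_0: "path_fps 0 {} = 1"
  by (rule fps_ext) (simp add: path_fps_def weingarten_paths_0)

lemma path_fps_Suc:
  assumes m: "m \<in> pair_partitions k" and k: "k > 0"
  shows "path_fps k m =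
    fps_X * (\<Sum>r\<in>{1..<2 * k - 1}.
      fps_const (1 / 2) * path_fps k (perm_act (Transposition.transpose r (2 * k - 1)) m)) +
    (if {2 * k - 1, 2 * k} \<in> m then path_fps (k - 1) (m - {{2 * k - 1, 2 * k}}) else 0)"
proof (rule fps_ext)
  fix l
  show "fps_nth (path_fps k m) l = fps_nth (fps_X * (\<Sum>r\<in>{1..<2 * k - 1}.
      fps_const (1 / 2) * path_fps k (perm_act (Transposition.transpose r (2 * k - 1)) m)) +
    (if {2 * k - 1, 2 * k} \<in> m then path_fps (k - 1) (m - {{2 * k - 1, 2 * k}}) else 0)) l"
  proof (cases l)
    case 0
    then show ?thesis by (simp add: path_fps_def card_weingarten_paths_Suc[OF assms])
  next
    case (Suc l')
    then show ?thesis
      by (simp add: path_fps_def card_weingarten_paths_Suc[OF assms] fps_sum_nth add_divide_distrib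
          sum_divide_distrib)
  qed
qed

lemma rational_path_fps: "m \<in> pair_partitions k \<Longrightarrow> rational_fps (path_fps k m)"
proof (induction k arbitrary: m)
  case 0
  then show ?case
    using rational_fps_fps_of_poly[of "1 :: real poly"] by (simp add: pair_partitions_0 path_fps_0)
next
  case (Suc k)
  let ?\<tau> = "\<lambda>r m. perm_act (Transposition.transpose r (2 * Suc k - 1)) m"
  let ?R = "{1..<2 * Suc k - 1}"
  define b where "b m = (if {2 * Suc k - 1, 2 * Suc k} \<in> m
    then path_fps k (m - {{2 * Suc k - 1, 2 * Suc k}}) else 0)" for m
  define c where "c m n = fps_const (if n \<in> (\<lambda>r. ?\<tau> r m) ` ?R then 1 / 2 else (0::real))" for m n
  show ?case
  proof (rule rational_fps_linear_system[OF finite_pair_partitions[of "Suc k"] _ _ _ Suc.prems])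
    fix m n
    show "rational_fps (c m n)"
      unfolding c_def fps_of_poly_const[symmetric] by (rule rational_fps_fps_of_poly)
  next
    fix m assume m: "m \<in> pair_partitions (Suc k)"
    show "rational_fps (b m)"
      using Suc.IH remove_last_block(1)[OF m] rational_fps_fps_of_poly[of "0 :: real poly"]
      by (simp add: b_def)
    \<comment> \<open>Distinct \<open>r\<close> have distinct targets, so the sum over arrows is a
      sum over pairings whose coefficients are 1/2 or 0. Loops give diagonal coefficients.\<close>
    have inj: "inj_on (\<lambda>r. ?\<tau> r m) ?R"
      using transpose_act_inj[OF m] by (intro inj_onI) blast
    have sub: "(\<lambda>r. ?\<tau> r m) ` ?R \<subseteq> pair_partitions (Suc k)"
      using transpose_act_in_pair_partitions[OF m] by auto
    have "(\<Sum>r\<in>?R. fps_const (1 / 2) * path_fps (Suc k) (?\<tau> r m)) =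
        (\<Sum>n\<in>(\<lambda>r. ?\<tau> r m) ` ?R. fps_const (1 / 2) * path_fps (Suc k) n)"
      by (simp only: sum.reindex[OF inj] comp_def)
    also have "\<dots> = (\<Sum>n\<in>pair_partitions (Suc k). c m n * path_fps (Suc k) n)"
      using sub finite_pair_partitions by (intro sum.mono_neutral_cong_left) (auto simp: c_def)
    finally show "path_fps (Suc k) m =
        fps_X * (\<Sum>n\<in>pair_partitions (Suc k). c m n * path_fps (Suc k) n) + b m"
      using path_fps_Suc[OF m] by (simp only: b_def diff_Suc_1 zero_less_Suc)
  qed
qed

section \<open>Values of the path series at large \<open>d\<close>\<close>

definition path_series :: "nat \<Rightarrow> nat \<Rightarrow> pairing \<Rightarrow> real" where
  "path_series d k m = eval_fps (path_fps k m) (inverse (real d)) / (2 * real d) ^ k"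

definition path_series_converges :: "nat \<Rightarrow> nat \<Rightarrow> bool" where
  "path_series_converges d k \<longleftrightarrow>
     (\<forall>m\<in>pair_partitions k. ereal (norm (inverse (real d))) < fps_conv_radius (path_fps k m))"

lemma eventually_path_series_converges:
  "\<forall>\<^sub>F d in sequentially. \<forall>j\<le>k. path_series_converges d j"
proof -
  have "\<forall>\<^sub>F d in sequentially. \<forall>j\<in>{..k}. \<forall>m\<in>pair_partitions j.
      ereal (norm (inverse (real d))) < fps_conv_radius (path_fps j m)"
    by (intro eventually_ball_finite ballI finite_pair_partitions finite_atMost
        eventually_inverse_in_conv_radius rational_fps_conv_radius_pos rational_path_fps)
  then show ?thesis unfolding path_series_converges_def by (auto elim: eventually_mono)
qed

text \<open>Allows the modulus to be dropped when the signed moment is identified with the path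
  series.\<close>

lemma path_series_nonneg:
  assumes "path_series_converges d k" "m \<in> pair_partitions k"
  shows "path_series d k m \<ge> 0"
proof -
  have "summable (\<lambda>n. fps_nth (path_fps k m) n * inverse (real d) ^ n)"
    using assms by (intro summable_fps) (auto simp: path_series_converges_def)
  then show ?thesis
    unfolding path_series_def eval_fps_def
    by (intro divide_nonneg_nonneg suminf_nonneg) (auto simp: path_fps_def)
qed

lemma path_series_recursion:
  assumes m: "m \<in> pair_partitions k" and k: "k > 0" and d: "d > 0"
    and conv: "\<forall>j\<le>k. path_series_converges d j"
  shows "2 * real d * path_series d k m =
    (\<Sum>r\<in>{1..<2 * k - 1}. path_series d k (perm_act (Transposition.transpose r (2 * k - 1)) m)) +
    (if {2 * k - 1, 2 * k} \<in> m then path_series d (k - 1) (m - {{2 * k - 1, 2 * k}}) else 0)"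
proof -
  let ?z = "inverse (real d)" and ?R = "{1..<2 * k - 1}"
  let ?\<tau> = "\<lambda>r. perm_act (Transposition.transpose r (2 * k - 1)) m"
  let ?b = "{2 * k - 1, 2 * k}"
  have rad: "ereal (norm ?z) < fps_conv_radius (path_fps k (?\<tau> r))" if "r \<in> ?R" for r
    using that conv transpose_act_in_pair_partitions[OF m, of r "2 * k - 1"]
    by (auto simp: path_series_converges_def)
  \<comment> \<open>Convergence is carried through the induction because additivity of
    \<open>eval_fps\<close> requires it of both summands.\<close>
  have sum: "ereal (norm ?z) < fps_conv_radius (\<Sum>r\<in>S. fps_const (1 / 2) * path_fps k (?\<tau> r)) \<and>
      eval_fps (\<Sum>r\<in>S. fps_const (1 / 2) * path_fps k (?\<tau> r)) ?z =
      (\<Sum>r\<in>S. eval_fps (path_fps k (?\<tau> r)) ?z / 2)" if "finite S" "S \<subseteq> ?R" for S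
    using that
  proof (induction S rule: finite_induct)
    case (insert r S)
    let ?f = "fps_const (1 / 2) * path_fps k (?\<tau> r)"
    have 1: "ereal (norm ?z) < fps_conv_radius ?f"
      using rad[of r] insert.prems fps_conv_radius_mult[of "fps_const (1 / 2)" "path_fps k (?\<tau> r)"]
      by (auto intro: less_le_trans)
    have 2: "eval_fps ?f ?z = eval_fps (path_fps k (?\<tau> r)) ?z / 2"
      using rad[of r] insert.prems by (subst eval_fps_mult) auto
    let ?S = "\<Sum>r\<in>S. fps_const (1 / 2) * path_fps k (?\<tau> r)"
    have IH: "ereal (norm ?z) < fps_conv_radius ?S"
      "eval_fps ?S ?z = (\<Sum>r\<in>S. eval_fps (path_fps k (?\<tau> r)) ?z / 2)"
      using insert by auto
    have "ereal (norm ?z) < min (fps_conv_radius ?f) (fps_conv_radius ?S)"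
      using 1 IH(1) by simp
    also have "\<dots> \<le> fps_conv_radius (?f + ?S)"
      by (rule fps_conv_radius_add)
    finally have 3: "ereal (norm ?z) < fps_conv_radius (?f + ?S)" .
    have "eval_fps (?f + ?S) ?z = eval_fps (path_fps k (?\<tau> r)) ?z / 2 + eval_fps ?S ?z"
      using eval_fps_add[OF 1 IH(1)] unfolding 2 .
    then show ?case
      unfolding sum.insert[OF insert.hyps] IH(2) using 3 by blast
  qed auto
  define T where "T = (\<Sum>r\<in>?R. fps_const (1 / 2) * path_fps k (?\<tau> r))"
  define B where "B = (if ?b \<in> m then path_fps (k - 1) (m - {?b}) else 0)"
  have T: "ereal (norm ?z) < fps_conv_radius T"
    "eval_fps T ?z = (\<Sum>r\<in>?R. eval_fps (path_fps k (?\<tau> r)) ?z / 2)"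
    using sum[of ?R] by (auto simp: T_def)
  have XT: "ereal (norm ?z) < fps_conv_radius (fps_X * T)"
    using T(1) fps_conv_radius_mult[of fps_X T] by (auto intro: less_le_trans)
  have B: "ereal (norm ?z) < fps_conv_radius B"
    using conv remove_last_block(1)[OF m] by (auto simp: B_def path_series_converges_def)
  have "eval_fps (path_fps k m) ?z = eval_fps (fps_X * T + B) ?z"
    unfolding path_fps_Suc[OF m k] T_def B_def ..
  also have "\<dots> = ?z * (\<Sum>r\<in>?R. eval_fps (path_fps k (?\<tau> r)) ?z / 2) + eval_fps B ?z"
    using XT B T by (simp add: eval_fps_add eval_fps_mult)
  finally have "2 * real d * eval_fps (path_fps k m) ?z =
      (\<Sum>r\<in>?R. eval_fps (path_fps k (?\<tau> r)) ?z) + 2 * real d * eval_fps B ?z"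
    using d by (simp add: sum_divide_distrib[symmetric] distrib_left)
  then have "2 * real d * path_series d k m =
      (\<Sum>r\<in>?R. path_series d k (?\<tau> r)) + 2 * real d * eval_fps B ?z / (2 * real d) ^ k"
    unfolding path_series_def sum_divide_distrib[symmetric] by (simp add: add_divide_distrib)
  also have "2 * real d * eval_fps B ?z / (2 * real d) ^ k =
      (if ?b \<in> m then path_series d (k - 1) (m - {?b}) else 0)"
    using d k by (cases k) (auto simp: B_def path_series_def)
  finally show ?thesis .
qed

context haar_sp
begin

lemma cmod_signed_moment_le_1:
  assumes "symp_compatible d k m j" "2 * k \<le> d"
  shows "cmod (signed_moment k j) \<le> 1"
  unfolding norm_signed_moment[OF assms(1)]
  using assms sp_row_less by (intro sp_moment_norm_le_1) (auto simp: symp_compatible_def)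

text \<open>Both sides solve the same linear system, in which the coupling to the other pairings is a
  contraction by the factor \<open>(2 k - 2) / (2 d) \<le> 1 / 2\<close>.\<close>

theorem signed_moment_eq_path_series:
  assumes "2 * k \<le> d" "d > 0" "\<forall>j\<le>k. path_series_converges d j"
    and "m \<in> pair_partitions k" "symp_compatible d k m j"
  shows "signed_moment k j = of_real (path_series d k m)"
  using assms
proof (induction k arbitrary: m j)
  case 0
  then show ?case
    by (simp add: pair_partitions_0 path_series_def path_fps_0 signed_moment_def order_sign_def
        sp_moment_def prob_space)
next
  case (Suc k)
  let ?K = "Suc k"
  let ?\<tau> = "\<lambda>r. Transposition.transpose r (2 * ?K - 1)"
  let ?b = "{2 * ?K - 1, 2 * ?K}"
  define D where "D m j = cmod (signed_moment ?K j - of_real (path_series d ?K m))" for m j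
  \<comment> \<open>The supremum runs over pairings and indices at once, since the arrows change
    both. It is finite: moments are bounded by 1 and there are finitely many pairings.\<close>
  define S where "S = {D m j | m j. m \<in> pair_partitions ?K \<and> symp_compatible d ?K m j}"
  have bdd: "bdd_above S"
  proof (rule bdd_aboveI)
    fix x assume "x \<in> S"
    then obtain m j where mj: "x = D m j" "m \<in> pair_partitions ?K" "symp_compatible d ?K m j"
      by (auto simp: S_def)
    have "D m j \<le> cmod (signed_moment ?K j) + \<bar>path_series d ?K m\<bar>"
      unfolding D_def by (metis norm_of_real norm_triangle_ineq4)
    also have "\<dots> \<le> 1 + (\<Sum>m\<in>pair_partitions ?K. \<bar>path_series d ?K m\<bar>)"
      using mj Suc.prems(1)
      by (intro add_mono cmod_signed_moment_le_1 member_le_sum finite_pair_partitions) auto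
    finally show "x \<le> 1 + (\<Sum>m\<in>pair_partitions ?K. \<bar>path_series d ?K m\<bar>)" using mj(1) by simp
  qed
  have S_I: "D m j \<in> S" if "m \<in> pair_partitions ?K" "symp_compatible d ?K m j" for m j
    using that unfolding S_def by blast
  have step: "D m j \<le> Sup S / 2" if m: "m \<in> pair_partitions ?K" and j: "symp_compatible d ?K m j" for m j
  proof -
    let ?n = "\<lambda>r. perm_act (?\<tau> r) m"
    have in_S: "D (?n r) (j \<circ> ?\<tau> r) \<in> S" if "r \<in> {1..<2 * ?K - 1}" for r
    proof -
      have r: "r \<in> {1..2 * ?K}" "2 * ?K - 1 \<in> {1..2 * ?K}" using that by auto
      show ?thesis
        by (rule S_I[OF transpose_act_in_pair_partitions[OF m r] symp_compatible_transpose[OF j r]])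
    qed
    have "0 \<le> D m j" by (simp add: D_def)
    also have "\<dots> \<le> Sup S" by (intro cSup_upper bdd S_I m j)
    finally have Sup_nonneg: "Sup S \<ge> 0" .
    have block: "(if ?b \<in> m then signed_moment (?K - 1) j else 0) =
        of_real (if ?b \<in> m then path_series d (?K - 1) (m - {?b}) else 0)"
    proof (cases "?b \<in> m")
      case True
      have "signed_moment k j = of_real (path_series d k (m - {?b}))"
      proof (rule Suc.IH)
        show "m - {?b} \<in> pair_partitions k" "symp_compatible d k (m - {?b}) j"
          using remove_last_block(1)[OF m True] symp_compatible_remove[OF j, of "{?b}"]
          by (simp_all only: diff_Suc_1)
      qed (use Suc.prems(1-3) in auto)
      then show ?thesis using True by simp
    qed simp
    have "2 * of_nat d * (signed_moment ?K j - of_real (path_series d ?K m)) =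
        2 * of_nat d * signed_moment ?K j - of_real (2 * real d * path_series d ?K m)"
      by (simp add: right_diff_distrib)
    also have "\<dots> = (\<Sum>r\<in>{1..<2 * ?K - 1}.
        signed_moment ?K (j \<circ> ?\<tau> r) - of_real (path_series d ?K (?n r)))"
      unfolding signed_moment_recursion[OF m zero_less_Suc Suc.prems(1) j]
        path_series_recursion[OF m zero_less_Suc Suc.prems(2,3)] block
      by (simp add: sum_subtractf)
    finally have "cmod (2 * of_nat d * (signed_moment ?K j - of_real (path_series d ?K m))) \<le>
        (\<Sum>r\<in>{1..<2 * ?K - 1}. D (?n r) (j \<circ> ?\<tau> r))"
      unfolding D_def by (simp only: norm_sum)
    also have "cmod (2 * of_nat d * (signed_moment ?K j - of_real (path_series d ?K m))) = 2 * real d * D m j"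
      by (simp add: D_def norm_mult)
    also have "(\<Sum>r\<in>{1..<2 * ?K - 1}. D (?n r) (j \<circ> ?\<tau> r)) \<le> (\<Sum>r\<in>{1..<2 * ?K - 1}. Sup S)"
      by (intro sum_mono cSup_upper bdd in_S)
    \<comment> \<open>At level \<open>?K\<close> there are \<open>2 * ?K - 2 = 2 * k\<close> solid
      arrows, and \<open>2 * ?K \<le> d\<close> bounds this by half of the factor \<open>2 d\<close>
      on the left.\<close>
    also have "\<dots> = real (2 * k) * Sup S" by simp
    also have "\<dots> \<le> real d * Sup S"
      using Suc.prems(1) Sup_nonneg by (intro mult_right_mono) auto
    finally show ?thesis using Suc.prems(2) by (simp add: field_simps)
  qed
  have "D m j \<in> S" by (rule S_I[OF Suc.prems(4,5)])
  \<comment> \<open>A finite supremum that is at most half of itself cannot be positive.\<close>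
  then have "Sup S \<le> Sup S / 2" by (intro cSup_least) (use step in \<open>auto simp: S_def\<close>)
  then have "D m j \<le> 0" using step[OF Suc.prems(4,5)] by simp
  then show ?case by (simp add: D_def)
qed

end

section \<open>The indices isolating a Weingarten coefficient, and the conclusion\<close>

lemma symplectic_index_block:
  assumes m: "m \<in> pair_partitions k" and b: "{x, y} \<in> m" "x < y"
  shows "symplectic_index d m x = x - 1" and "symplectic_index d m y = x - 1 + d"
proof -
  have "(THE c. c \<in> m \<and> z \<in> c) = {x, y}" if "z \<in> {x, y}" for z
  proof (rule the_equality)
    fix c assume "c \<in> m \<and> z \<in> c"
    then show "c = {x, y}" using pair_partitionsD(2)[OF m _ b(1) _ that] by blast
  qed (use b(1) that in blast)
  then show "symplectic_index d m x = x - 1" "symplectic_index d m y = x - 1 + d"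
    using b(2) by (simp_all add: symplectic_index_def Let_def)
qed

lemma base_pairing_in_pair_partitions: "base_pairing k \<in> pair_partitions k"
proof -
  have "\<Union>(base_pairing k) = {1..2 * k}"
  proof
    show "{1..2 * k} \<subseteq> \<Union>(base_pairing k)"
    proof
      fix x assume "x \<in> {1..2 * k}"
      then have "x \<in> {2 * ((x + 1) div 2) - 1, 2 * ((x + 1) div 2)}" "(x + 1) div 2 \<in> {1..k}"
        by (auto; presburger)+
      then show "x \<in> \<Union>(base_pairing k)" unfolding base_pairing_def by blast
    qed
  qed (auto simp: base_pairing_def)
  moreover have "b \<inter> c = {}" if bc: "b \<in> base_pairing k" "c \<in> base_pairing k" "b \<noteq> c" for b c
  proof -
    obtain r s where "b = {2 * r - 1, 2 * r}" "c = {2 * s - 1, 2 * s}" "r \<in> {1..k}" "s \<in> {1..k}"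
      using bc(1,2) unfolding base_pairing_def by blast
    moreover from this have "r \<noteq> s" using bc(3) by blast
    ultimately show ?thesis by auto
  qed
  moreover have "card b = 2" if "b \<in> base_pairing k" for b
    using that by (auto simp: base_pairing_def card_2_iff) force+
  moreover have "{} \<notin> base_pairing k" by (auto simp: base_pairing_def)
  ultimately show ?thesis
    by (auto simp: pair_partitions_def partition_on_def disjoint_def)
qed

lemma symplectic_index_base:
  assumes "r \<in> {1..2 * k}"
  shows "symplectic_index d (base_pairing k) r = sp_row d r"
proof -
  define q where "q = (r + 1) div 2"
  have q: "q \<in> {1..k}" "r = 2 * q - 1 \<or> r = 2 * q"
    using assms by (auto simp: q_def; presburger)+
  then have "{2 * q - 1, 2 * q} \<in> base_pairing k" unfolding base_pairing_def by blast
  from symplectic_index_block[OF base_pairing_in_pair_partitions this] q show ?thesis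
    by (auto simp: sp_row_def)
qed

lemma symplectic_index_compatible:
  assumes m: "m \<in> pair_partitions k" and d: "2 * k \<le> d"
  shows "symp_compatible d k m (symplectic_index d m)"
proof -
  let ?j = "symplectic_index d m"
  have cases: "\<exists>x y. {x, y} \<in> m \<and> x < y \<and> 1 \<le> x \<and> y \<le> 2 * k \<and>
      (r = x \<and> ?j r = x - 1 \<or> r = y \<and> ?j r = x - 1 + d)" if "r \<in> {1..2 * k}" for r
  proof -
    have "r \<in> \<Union>m" using that unfolding pair_partitionsD(1)[OF m] .
    then obtain b where b: "b \<in> m" "r \<in> b" by (rule UnionE)
    obtain x y where xy: "b = {x, y}" "x < y" "x \<in> {1..2 * k}" "y \<in> {1..2 * k}"
      by (rule pair_partitions_blockE[OF m b(1)])
    have m_xy: "{x, y} \<in> m" using b(1) xy(1) by simp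
    note idx = symplectic_index_block[OF m m_xy xy(2), of d]
    have "r = x \<or> r = y" using b(2) xy(1) by simp
    then have "r = x \<and> ?j r = x - 1 \<or> r = y \<and> ?j r = x - 1 + d"
      using idx by (elim disjE) simp_all
    moreover have "1 \<le> x" "y \<le> 2 * k" using xy(3,4) by simp_all
    ultimately show ?thesis using m_xy xy(2) by blast
  qed
  have "?j \<in> {1..2 * k} \<rightarrow> {..<2 * d}"
  proof
    fix r assume "r \<in> {1..2 * k}"
    from cases[OF this] d show "?j r \<in> {..<2 * d}" by auto
  qed
  moreover have "inj_on ?j {1..2 * k}"
  proof (rule inj_onI)
    fix r s assume rs: "r \<in> {1..2 * k}" "s \<in> {1..2 * k}" "?j r = ?j s"
    obtain x y where x: "{x, y} \<in> m" "x < y" "1 \<le> x" "y \<le> 2 * k"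
      "r = x \<and> ?j r = x - 1 \<or> r = y \<and> ?j r = x - 1 + d" using cases[OF rs(1)] by blast
    obtain x' y' where x': "{x', y'} \<in> m" "x' < y'" "1 \<le> x'" "y' \<le> 2 * k"
      "s = x' \<and> ?j s = x' - 1 \<or> s = y' \<and> ?j s = x' - 1 + d" using cases[OF rs(2)] by blast
    \<comment> \<open>Smaller elements of blocks receive indices below \<open>d\<close> and larger
      ones indices from \<open>d\<close> on, as \<open>2 * k \<le> d\<close>. Either index reveals
      the smaller element.\<close>
    have "x = x'" using x(2-5) x'(2-5) rs(3) d by auto
    moreover have "y = y'" using pair_partitions_partner_unique[OF m, of x y y'] x(1) x'(1) calculation by simp
    ultimately show "r = s" using x(2-5) x'(2-5) rs(3) d by auto
  qed
  moreover have "?j y = symp_partner d (?j x)" if xy: "{x, y} \<in> m" for x y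
  proof -
    obtain u v where uv: "{x, y} = {u, v}" "u < v" "u \<in> {1..2 * k}" "v \<in> {1..2 * k}"
      by (rule pair_partitions_blockE[OF m xy])
    then have "{u, v} \<in> m" using xy by simp
    from symplectic_index_block[OF m this uv(2)] uv d show ?thesis
      by (auto simp: doubleton_eq_iff symp_partner_def)
  qed
  ultimately show ?thesis by (simp add: symp_compatible_def)
qed

theorem theorem4p8:
  fixes k :: nat and m :: pairing and \<mu> :: "nat \<Rightarrow> complex mat measure"
  assumes haar: "\<And>d. haar_probability (2 * d) (Sp d) (\<mu> d)"
    and m: "m \<in> pair_partitions k"
  shows "has_formal_expansion
           (\<lambda>d. (2 * real d) ^ (pairing_length k m + k) * cmod (Wg_Sp (\<mu> d) k m d))
           (\<lambda>g. real (card (weingarten_paths k m (pairing_length k m + g))) / 2 ^ g)"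
proof (rule has_formal_expansionI)
  define n where "n = pairing_length k m"
  define a where "a = (\<lambda>g. real (card (weingarten_paths k m (n + g))) / 2 ^ g)"
  \<comment> \<open>Below \<open>n\<close> both sides vanish, as there are no paths with fewer than
    \<open>n\<close> solid steps. Above it, \<open>path_fps\<close> divides by
    \<open>2 ^ (n + g)\<close> and \<open>a\<close> only by \<open>2 ^ g\<close>.\<close>
  have shift: "fps_X ^ n * Abs_fps a = fps_const (2 ^ n) * path_fps k m"
  proof (rule fps_ext)
    fix l
    show "fps_nth (fps_X ^ n * Abs_fps a) l = fps_nth (fps_const (2 ^ n) * path_fps k m) l"
    proof (cases "l < n")
      case True
      then show ?thesis
        using weingarten_paths_empty[OF m] by (simp add: fps_X_power_mult_nth path_fps_def n_def)
    next
      case False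
      then obtain g where "l = n + g" using le_Suc_ex not_less by blast
      then show ?thesis by (simp add: fps_X_power_mult_nth path_fps_def a_def power_add)
    qed
  qed
  have "rational_fps (fps_X ^ n * Abs_fps a)"
    unfolding shift fps_of_poly_const[symmetric]
    by (intro rational_fps_mult rational_fps_fps_of_poly rational_path_fps m)
  then have rat: "rational_fps (Abs_fps a)" by (rule rational_fps_shift)
  then show "rational_fps (Abs_fps (\<lambda>g. real (card (weingarten_paths k m (pairing_length k m + g))) / 2 ^ g))"
    unfolding a_def n_def .
  have "\<forall>\<^sub>F d in sequentially.
      (2 * real d) ^ (n + k) * cmod (Wg_Sp (\<mu> d) k m d) = eval_fps (Abs_fps a) (inverse (real d))"
    using eventually_ge_at_top[of "2 * k"] eventually_gt_at_top[of 0]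
      eventually_path_series_converges[of k]
      eventually_inverse_in_conv_radius[OF rational_fps_conv_radius_pos[OF rat]]
  proof eventually_elim
    case (elim d)
    interpret haar_sp d "\<mu> d" by unfold_locales (rule haar)
    let ?j = "symplectic_index d m" and ?z = "inverse (real d)"
    have j: "symp_compatible d k m ?j" by (rule symplectic_index_compatible[OF m elim(1)])
    have "Wg_Sp (\<mu> d) k m d = sp_moment (\<mu> d) {1..2 * k} (symplectic_index d (base_pairing k)) ?j"
      by (simp add: Wg_Sp_def sp_moment_def)
    also have "\<dots> = sp_moment (\<mu> d) {1..2 * k} (sp_row d) ?j"
      by (intro sp_moment_cong symplectic_index_base refl)
    finally have "cmod (Wg_Sp (\<mu> d) k m d) = cmod (signed_moment k ?j)"
      using norm_signed_moment[OF j] by simp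
    also have "\<dots> = path_series d k m"
      using signed_moment_eq_path_series[OF elim(1-3) m j] path_series_nonneg[OF _ m] elim(3) by simp
    finally have W: "cmod (Wg_Sp (\<mu> d) k m d) = path_series d k m" .
    have "?z ^ n * eval_fps (Abs_fps a) ?z = eval_fps (fps_X ^ n * Abs_fps a) ?z"
      using elim(4) by (subst eval_fps_mult) auto
    also have "\<dots> = 2 ^ n * eval_fps (path_fps k m) ?z"
      unfolding shift using elim(3) m by (subst eval_fps_mult) (auto simp: path_series_converges_def)
    finally have "eval_fps (Abs_fps a) ?z = (2 * real d) ^ n * eval_fps (path_fps k m) ?z"
      using elim(2) by (simp add: field_simps power_mult_distrib)
    then show ?case
      using elim(2) by (simp add: W path_series_def power_add)
  qed
  then show "\<forall>\<^sub>F d in sequentially. (2 * real d) ^ (pairing_length k m + k) * cmod (Wg_Sp (\<mu> d) k m d) =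
      eval_fps (Abs_fps (\<lambda>g. real (card (weingarten_paths k m (pairing_length k m + g))) / 2 ^ g)) (inverse (real d))"
    unfolding a_def n_def .
qed

end
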